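(* Let $R$ be a polynomial ring in finitely many variables over an $F$-finite field of characteristic $p>0$, let $f\in R$, and let $B$ be a positive integer such that $\mathbb{J}(f)\cap[0,1)$ has at most $B$ elements. Let $\lambda\in\mathscr{A}_B$ with $\lambda>0$, let $\epsilon_p(\lambda)=(u,v)$, and set $s=u+vB$. Then $\lambda$ is an $F$-jumping number of $f$ if and only if \[\tau\bigl(f^{\langle\lambda\rangle_s}\bigr)\neq\tau\bigl(f^{\langle\lambda\rangle_s+p^{-s}}\bigr),\] where these two ideals are given by $\tau(f^{\langle\lambda\rangle_s})=\bigl(f^{\lceil p^s\lambda\rceil-1}\bigr)^{[1/p^s]}$ and $\tau(f^{\langle\lambda\rangle_s+p^{-s}})=\bigl(f^{\lceil p^s\lambda\rceil}\bigr)^{[1/p^s]}$.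
   Context: $\mathbb{N}$ contains $0$, $\mathbb{N}_+$ is the set of positive integers and $\mathbb{Q}_+$ the set of positive rationals. A field $\mathbb{L}$ of characteristic $p>0$ is $F$-finite if $[\mathbb{L}:\mathbb{L}^p]<\infty$. For an ideal $\mathfrak{b}$ of $R$, $\mathfrak{b}^{[p^e]}$ is the ideal generated by the $p^e$-th powers of elements of $\mathfrak{b}$. For $g\in R$ and $e\ge 1$, $(g)^{[1/p^e]}$ is the smallest ideal $\mathfrak{b}$ of $R$ with $g\in\mathfrak{b}^{[p^e]}$. For real $\lambda\ge0$, the test ideal is $\tau(f^{\lambda})=\bigcup_{e\ge1}\bigl(f^{\lceil p^e\lambda\rceil}\bigr)^{[1/p^e]}$ (an ascending union). A real $\xi\ge0$ is an $F$-jumping number of $f$ if $\xi=0$, or $\xi>0$ and $\tau(f^{\xi})\neq\tau(f^{\xi-\varepsilon})$ for every $0<\varepsilon<\xi$; $\mathbb{J}(f)$ is the set of all $F$-jumping numbers. For real $\lambda>0$ and $e\in\mathbb{N}$, $\langle\lambda\rangle_e=\frac{\lceil p^e\lambda\rceil-1}{p^e}$. For $\lambda\in\mathbb{Q}_+$, $\mathscr{E}_p(\lambda)=\{(a,b)\in\mathbb{N}\times\mathbb{N}_+: p^a(p^b-1)\lambda\in\mathbb{N}\}$. Writing $\lambda=p^{\nu}\cdot\frac{m}{n}$ with $\nu\in\mathbb{Z}$, $m,n$ positive integers, and $p,m,n$ pairwise relatively prime, $\epsilon_p(\lambda)=\bigl(\max\{-\nu,0\},\min\{t\ge1:p^t\equiv1\bmod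 n\}\bigr)\in\mathscr{E}_p(\lambda)$. Finally $\mathscr{A}_B=\{\lambda\in\mathbb{Q}_+:\exists\,(a,b)\in\mathscr{E}_p(\lambda)\text{ with }a+b\le B\}\cup\{0\}$. *)

theory Defs
  imports Complex_Main
    "HOL-Algebra.Algebraic_Closure_Type"
    "HOL-Library.Poly_Mapping"
    "HOL-Number_Theory.Cong"
begin

text \<open>
  The library constant \<open>ring_of_type_algebra\<close> is the \<open>HOL-Algebra\<close> ring record of a type-class ring.
  Below, the ring \<open>K[X\<^sub>0, \<dots>, X\<^sub>n\<^sub>-\<^sub>1]\<close> is the set of those polynomials (finitely supported
  coefficient functions on finitely supported exponent vectors) that involve only variables with
  index less than \<open>n\<close>; the case \<open>n = 0\<close> is included.
\<close>

definition mpoly_ring :: "nat \<Rightarrow> ((nat \<Rightarrow>\<^sub>0 nat) \<Rightarrow>\<^sub>0 'k::comm_ring_1) ring" where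
  "mpoly_ring n = ring_of_type_algebra
     \<lparr>carrier := {P. \<forall>m \<in> Poly_Mapping.keys P. Poly_Mapping.keys m \<subseteq> {..<n}}\<rparr>"

lemma mpoly_ring_simps [simp]:
  "carrier (mpoly_ring n) = {P. \<forall>m \<in> Poly_Mapping.keys P. Poly_Mapping.keys m \<subseteq> {..<n}}"
  "x \<otimes>\<^bsub>mpoly_ring n\<^esub> y = x * y"
  "x \<oplus>\<^bsub>mpoly_ring n\<^esub> y = x + y"
  "\<one>\<^bsub>mpoly_ring n\<^esub> = 1"
  "\<zero>\<^bsub>mpoly_ring n\<^esub> = 0"
  by (simp_all add: mpoly_ring_def ring_of_type_algebra_def)

lemma cring_mpoly_ring:
  "cring (mpoly_ring n :: ((nat \<Rightarrow>\<^sub>0 nat) \<Rightarrow>\<^sub>0 'k::comm_ring_1) ring)" (is "cring ?R")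
proof (rule cringI)
  have add: "x + y \<in> carrier ?R" if "x \<in> carrier ?R" "y \<in> carrier ?R" for x y
    using that Poly_Mapping.keys_add[of x y] by fastforce
  have uminus: "- x \<in> carrier ?R" if "x \<in> carrier ?R" for x
    using that by (simp add: in_keys_iff lookup_uminus)
  have mult: "x * y \<in> carrier ?R" if "x \<in> carrier ?R" "y \<in> carrier ?R" for x y
  proof -
    have "Poly_Mapping.keys m \<subseteq> {..<n}" if m: "m \<in> Poly_Mapping.keys (x * y)" for m
    proof -
      obtain a b where ab: "m = a + b" "a \<in> Poly_Mapping.keys x" "b \<in> Poly_Mapping.keys y"
        using Poly_Mapping.keys_mult[of x y] m by blast
      have "Poly_Mapping.keys m \<subseteq> Poly_Mapping.keys a \<union> Poly_Mapping.keys b"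
        unfolding ab(1) by (rule Poly_Mapping.keys_add)
      then show ?thesis
        using ab \<open>x \<in> carrier ?R\<close> \<open>y \<in> carrier ?R\<close> by auto
    qed
    then show ?thesis by simp
  qed
  show "abelian_group ?R"
  proof (rule abelian_groupI)
    fix x assume "x \<in> carrier ?R"
    then show "\<exists>y\<in>carrier ?R. y \<oplus>\<^bsub>?R\<^esub> x = \<zero>\<^bsub>?R\<^esub>"
      using uminus[of x] by (intro bexI[of _ "- x"]) simp_all
  next
    show "x \<oplus>\<^bsub>?R\<^esub> y \<in> carrier ?R" if "x \<in> carrier ?R" "y \<in> carrier ?R" for x y
      using add[OF that] by (simp only: mpoly_ring_simps)
  qed (simp_all only: mpoly_ring_simps, simp_all add: ac_simps)
  show "Group.comm_monoid ?R"
  proof (rule Group.comm_monoidI)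
    show "x \<otimes>\<^bsub>?R\<^esub> y \<in> carrier ?R" if "x \<in> carrier ?R" "y \<in> carrier ?R" for x y
      using mult[OF that] by (simp only: mpoly_ring_simps)
  qed (simp_all only: mpoly_ring_simps, simp_all add: ac_simps)
qed (simp only: mpoly_ring_simps, rule distrib_right)

definition F_finite :: "('a, 'b) ring_scheme \<Rightarrow> nat \<Rightarrow> bool" where
  "F_finite L p \<longleftrightarrow> ring.finite_dimension L ((\<lambda>x. x [^]\<^bsub>L\<^esub> p) ` carrier L) (carrier L)"

text \<open>In the next two definitions, \<open>b\<^sup>[\<^sup>q\<^sup>]\<close> and \<open>(g)\<^sup>[\<^sup>1\<^sup>/\<^sup>q\<^sup>]\<close>, where \<open>q = p ^ e\<close>; the
  latter is the least ideal with respect to inclusion, which is the order on sets.\<close>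

definition frobenius_power :: "('a, 'b) ring_scheme \<Rightarrow> nat \<Rightarrow> nat \<Rightarrow> 'a set \<Rightarrow> 'a set" where
  "frobenius_power R p e b = Idl\<^bsub>R\<^esub> ((\<lambda>x. x [^]\<^bsub>R\<^esub> (p ^ e)) ` b)"

definition frobenius_root :: "('a, 'b) ring_scheme \<Rightarrow> nat \<Rightarrow> nat \<Rightarrow> 'a \<Rightarrow> 'a set" where
  "frobenius_root R p e g = (LEAST b. ideal b R \<and> g \<in> frobenius_power R p e b)"

definition test_ideal :: "('a, 'b) ring_scheme \<Rightarrow> nat \<Rightarrow> 'a \<Rightarrow> real \<Rightarrow> 'a set" where
  "test_ideal R p f \<alpha> = (\<Union>e\<in>{1..}. frobenius_root R p e (f [^]\<^bsub>R\<^esub> (nat \<lceil>real p ^ e * \<alpha>\<rceil>)))"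

definition F_jumping_numbers :: "('a, 'b) ring_scheme \<Rightarrow> nat \<Rightarrow> 'a \<Rightarrow> real set" where
  "F_jumping_numbers R p f = {\<xi>. \<xi> = 0 \<or>
     \<xi> > 0 \<and> (\<forall>\<epsilon>. 0 < \<epsilon> \<and> \<epsilon> < \<xi> \<longrightarrow> test_ideal R p f \<xi> \<noteq> test_ideal R p f (\<xi> - \<epsilon>))}"

definition truncation :: "nat \<Rightarrow> nat \<Rightarrow> real \<Rightarrow> real" where
  "truncation p e \<alpha> = (of_int \<lceil>real p ^ e * \<alpha>\<rceil> - 1) / real p ^ e"

definition exponent_pairs :: "nat \<Rightarrow> real \<Rightarrow> (nat \<times> nat) set" where
  "exponent_pairs p \<alpha> = {(a, b). b > 0 \<and> real p ^ a * (real p ^ b - 1) * \<alpha> \<in> \<nat>}"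

text \<open>The decomposition \<open>\<alpha> = p\<^sup>\<nu> m / n\<close> of a positive rational is unique, so that the description
  below determines the pair.\<close>

definition minimal_exponent_pair :: "nat \<Rightarrow> real \<Rightarrow> nat \<times> nat" where
  "minimal_exponent_pair p \<alpha> = (THE uv. \<exists>(\<nu>::int) (m::nat) (n::nat).
     m > 0 \<and> n > 0 \<and> coprime p m \<and> coprime p n \<and> coprime m n \<and>
     \<alpha> = real p powi \<nu> * (real m / real n) \<and>
     uv = (nat (max (- \<nu>) 0), LEAST t. t \<ge> 1 \<and> [p ^ t = 1] (mod n)))"

definition bounded_rationals :: "nat \<Rightarrow> nat \<Rightarrow> real set" where
  "bounded_rationals p B =
     {\<alpha> \<in> \<rat>. \<alpha> > 0 \<and> (\<exists>(a, b) \<in> exponent_pairs p \<alpha>. a + b \<le> B)} \<union> {0}"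

end

theory Submission
  imports Defs "HOL-Number_Theory.Residues"
begin

text \<open>
  The polynomial ring has a finite dual basis over its subring of \<open>q\<close>-th powers: coordinates
  \<open>\<pi>\<^sub>i\<close> with \<open>x = \<Sum>\<^sub>i \<pi>\<^sub>i(x)\<^sup>q \<beta>\<^sub>i\<close>. Hence \<open>x \<in> J\<^sup>[\<^sup>q\<^sup>]\<close> iff all \<open>\<pi>\<^sub>i(x)\<close> lie in \<open>J\<close>, and
  \<open>(g)\<^sup>[\<^sup>1\<^sup>/\<^sup>q\<^sup>]\<close> is generated by the \<open>\<pi>\<^sub>i(g)\<close>; in particular it is finitely generated, which makes a
  Noetherian argument unnecessary. As \<open>(f)\<^sup>[\<^sup>1\<^sup>/\<^sup>q\<^sup>]\<close> is the unit ideal for \<open>f \<noteq> 0\<close> and large \<open>q\<close>,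
  test ideals are right constant wherever they are finitely generated, so a change of test
  ideals between \<open>\<langle>\<alpha>\<rangle>\<^sub>s\<close> and \<open>\<langle>\<alpha>\<rangle>\<^sub>s + p\<^sup>-\<^sup>s\<close> produces a jumping number \<open>\<mu>\<close> in that interval.

  Jumping numbers are stable under multiplication by \<open>p\<close> and under passing to the fractional
  part in \<open>(0, 1]\<close>. Applied to \<open>p\<^sup>u\<^sup>+\<^sup>v\<^sup>j \<mu>\<close> for \<open>0 \<le> j \<le> B\<close>, this gives \<open>B + 1\<close> different jumping
  numbers in \<open>(0, 1]\<close> unless \<open>\<mu> = \<alpha>\<close>. Membership in \<open>\<A>\<^sub>B\<close> ensures \<open>p\<^sup>s \<alpha> > 1\<close>, that
  is \<open>\<langle>\<alpha>\<rangle>\<^sub>s > 0\<close>, without which \<open>f = 0\<close> would be a counterexample.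
\<close>

section \<open>Frobenius powers and roots\<close>

text \<open>The coordinates are stored with their \<open>q\<close>-th root already extracted, which
  is why they are semilinear: \<open>a ^ q\<close> comes out as \<open>a\<close>. The condition is a
  dual basis identity, i.e. finitely generated projectivity over the \<open>q\<close>-th powers;
  independence of the \<open>\<beta> i\<close> is not asserted.\<close>

definition frobenius_dual_basis ::
    "'a::comm_ring_1 set \<Rightarrow> nat \<Rightarrow> 'i set \<Rightarrow> ('i \<Rightarrow> 'a \<Rightarrow> 'a) \<Rightarrow> ('i \<Rightarrow> 'a) \<Rightarrow> bool" where
  "frobenius_dual_basis C q I \<pi> \<beta> \<longleftrightarrow> finite I
     \<and> (\<forall>i\<in>I. \<beta> i \<in> C \<and> (\<forall>x\<in>C. \<pi> i x \<in> C)
           \<and> (\<forall>x\<in>C. \<forall>y\<in>C. \<pi> i (x + y) = \<pi> i x + \<pi> i y)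
           \<and> (\<forall>a\<in>C. \<forall>x\<in>C. \<pi> i (a ^ q * x) = a * \<pi> i x))
     \<and> (\<forall>x\<in>C. x = (\<Sum>i\<in>I. \<pi> i x ^ q * \<beta> i))"

lemma frobenius_dual_basisD:
  assumes "frobenius_dual_basis C q I \<pi> \<beta>"
  shows "finite I"
    and "i \<in> I \<Longrightarrow> \<beta> i \<in> C"
    and "i \<in> I \<Longrightarrow> x \<in> C \<Longrightarrow> \<pi> i x \<in> C"
    and "i \<in> I \<Longrightarrow> x \<in> C \<Longrightarrow> y \<in> C \<Longrightarrow> \<pi> i (x + y) = \<pi> i x + \<pi> i y"
    and "i \<in> I \<Longrightarrow> a \<in> C \<Longrightarrow> x \<in> C \<Longrightarrow> \<pi> i (a ^ q * x) = a * \<pi> i x"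
    and "x \<in> C \<Longrightarrow> (\<Sum>i\<in>I. \<pi> i x ^ q * \<beta> i) = x"
  using assms by (simp_all add: frobenius_dual_basis_def)

text \<open>Existence cannot be quantified over the type of indices. Renumbering by an initial
  segment of the naturals makes it expressible in a locale assumption and in an induction.\<close>

lemma frobenius_dual_basis_reindex:
  assumes "frobenius_dual_basis C q I \<pi> \<beta>"
  shows "\<exists>(n::nat) \<pi> \<beta>. frobenius_dual_basis C q {..<n} \<pi> \<beta>"
proof -
  have fin: "finite I"
    using assms by (simp add: frobenius_dual_basis_def)
  obtain h where h: "bij_betw h {..<card I} I"
    using ex_bij_betw_nat_finite[OF fin] by (auto simp: atLeast0LessThan)
  then have hI: "h i \<in> I" if "i < card I" for i
    using that by (auto simp: bij_betw_def)
  have "x = (\<Sum>i<card I. \<pi> (h i) x ^ q * \<beta> (h i))" if "x \<in> C" for x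
  proof -
    have "x = (\<Sum>i\<in>I. \<pi> i x ^ q * \<beta> i)"
      using frobenius_dual_basisD(6)[OF assms that] by simp
    also have "\<dots> = (\<Sum>i<card I. \<pi> (h i) x ^ q * \<beta> (h i))"
      using sum.reindex_bij_betw[OF h, of "\<lambda>i. \<pi> i x ^ q * \<beta> i"] by simp
    finally show ?thesis .
  qed
  then have "frobenius_dual_basis C q {..<card I} (\<lambda>i. \<pi> (h i)) (\<lambda>i. \<beta> (h i))"
    using hI frobenius_dual_basisD[OF assms] unfolding frobenius_dual_basis_def by simp
  then show ?thesis by blast
qed

text \<open>\<open>R\<close> is a subring of a type-class ring with the inherited operations, so
  computations use \<open>+\<close> and \<open>^\<close> of the type, and its characteristic gives
  additivity of Frobenius everywhere.\<close>

locale frobenius_ring = cring R for R :: "'a::comm_ring_1 ring" +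
  fixes p :: nat
  assumes R_type_ring: "R = ring_of_type_algebra\<lparr>carrier := carrier R\<rparr>"
    and CHAR_eq: "CHAR('a) = p" and prime_p: "prime p"
    and ex_dual_basis: "\<exists>(n::nat) \<pi> \<beta>. frobenius_dual_basis (carrier R) p {..<n} \<pi> \<beta>"
begin

lemma ring_ops [simp]: "x \<otimes>\<^bsub>R\<^esub> y = x * y" "x \<oplus>\<^bsub>R\<^esub> y = x + y" "\<one>\<^bsub>R\<^esub> = 1" "\<zero>\<^bsub>R\<^esub> = 0"
  by (subst R_type_ring; simp add: ring_of_type_algebra_def)+

lemma nat_pow_eq [simp]: "x [^]\<^bsub>R\<^esub> (k::nat) = x ^ k"
  by (induction k) (simp_all add: mult.commute)

lemma carrier_closed:
  "0 \<in> carrier R" "1 \<in> carrier R"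
  "x \<in> carrier R \<Longrightarrow> y \<in> carrier R \<Longrightarrow> x + y \<in> carrier R"
  "x \<in> carrier R \<Longrightarrow> y \<in> carrier R \<Longrightarrow> x * y \<in> carrier R"
  "x \<in> carrier R \<Longrightarrow> x ^ k \<in> carrier R"
  using zero_closed one_closed a_closed[of x y] m_closed[of x y] nat_pow_closed[of x k] by simp_all

lemma sum_carrier: "(\<And>i. i \<in> I \<Longrightarrow> g i \<in> carrier R) \<Longrightarrow> sum g I \<in> carrier R"
  by (induction I rule: infinite_finite_induct) (auto intro: carrier_closed)

lemma ideal_iff:
  "ideal J R \<longleftrightarrow> J \<subseteq> carrier R \<and> 0 \<in> J \<and> (\<forall>x\<in>J. \<forall>y\<in>J. x + y \<in> J) \<and> (\<forall>c\<in>carrier R. \<forall>x\<in>J. c * x \<in> J)"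
    (is "_ \<longleftrightarrow> ?r")
proof
  assume "ideal J R"
  then interpret J: ideal J R .
  show ?r
    using J.a_subset J.zero_closed J.a_closed J.I_l_closed by auto
next
  assume r: ?r
  show "ideal J R"
  proof (rule idealI)
    show "ring R" by (rule ring_axioms)
    show "subgroup J (add_monoid R)"
    proof (rule subgroup.intro)
      fix x assume x: "x \<in> J"
      then have "x \<in> carrier R" using r by auto
      \<comment> \<open>Negation is multiplication by the ring element minus one, so closure under
        scalars suffices.\<close>
      then have "inv\<^bsub>add_monoid R\<^esub> x = (\<ominus>\<^bsub>R\<^esub> \<one>\<^bsub>R\<^esub>) * x"
        using l_minus[OF one_closed, of x] by (simp add: a_inv_def)
      then show "inv\<^bsub>add_monoid R\<^esub> x \<in> J"
        using r x a_inv_closed[OF one_closed] by auto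
    qed (use r in auto)
    show "x \<otimes>\<^bsub>R\<^esub> a \<in> J" "a \<otimes>\<^bsub>R\<^esub> x \<in> J" if "a \<in> J" "x \<in> carrier R" for a x
      using r that by (simp_all add: mult.commute[of a x])
  qed
qed

lemma ideal_zero: "ideal J R \<Longrightarrow> 0 \<in> J"
  and ideal_add: "ideal J R \<Longrightarrow> x \<in> J \<Longrightarrow> y \<in> J \<Longrightarrow> x + y \<in> J"
  and ideal_mult: "ideal J R \<Longrightarrow> c \<in> carrier R \<Longrightarrow> x \<in> J \<Longrightarrow> c * x \<in> J"
  and ideal_subset: "ideal J R \<Longrightarrow> J \<subseteq> carrier R"
  by (auto simp: ideal_iff)

lemma ideal_sum: "ideal J R \<Longrightarrow> (\<And>i. i \<in> I \<Longrightarrow> g i \<in> J) \<Longrightarrow> sum g I \<in> J"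
  by (induction I rule: infinite_finite_induct) (auto simp: ideal_zero ideal_add)

lemma ideal_principal_le:
  "ideal J R \<Longrightarrow> g \<in> carrier R \<Longrightarrow> (\<lambda>x. g * x) ` carrier R \<subseteq> J \<longleftrightarrow> g \<in> J"
  using ideal_mult[of J _ g] imageI[OF carrier_closed(2), of "(*) g"] by (auto simp: mult.commute[of g])

section \<open>Additivity of Frobenius and its iterates\<close>

lemma freshman: "(x + y :: 'a) ^ (p ^ e) = x ^ (p ^ e) + y ^ (p ^ e)"
  by (rule freshmans_dream'[of "p ^ e" e]) (simp_all add: CHAR_eq prime_p)

lemma freshman_sum: "(\<Sum>i\<in>I. g i :: 'a) ^ (p ^ e) = (\<Sum>i\<in>I. g i ^ (p ^ e))"
  by (rule freshmans_dream_sum'[of "p ^ e" e]) (simp_all add: CHAR_eq prime_p)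

text \<open>Expand each coordinate \<open>\<pi> i x\<close> along the basis for exponent
  \<open>p\<close> and raise to the additive power \<open>p ^ e\<close>. This gives composite
  coordinates \<open>\<rho> j (\<pi> i x)\<close> with basis elements
  \<open>\<gamma> j ^ (p ^ e) * \<beta> i\<close>.\<close>

lemma dual_basis_power: "\<exists>(n::nat) \<pi> \<beta>. frobenius_dual_basis (carrier R) (p ^ e) {..<n} \<pi> \<beta>"
proof (induction e)
  case 0
  have "frobenius_dual_basis (carrier R) (p ^ 0) {..<1::nat} (\<lambda>_ x. x) (\<lambda>_. 1)"
    by (simp add: frobenius_dual_basis_def carrier_closed lessThan_Suc)
  then show ?case by blast
next
  case (Suc e)
  let ?C = "carrier R"
  obtain n :: nat and \<pi> \<beta> where d1: "frobenius_dual_basis ?C (p ^ e) {..<n} \<pi> \<beta>"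
    using Suc by blast
  obtain m :: nat and \<rho> \<gamma> where d2: "frobenius_dual_basis ?C p {..<m} \<rho> \<gamma>"
    using ex_dual_basis by blast
  note D = frobenius_dual_basisD[OF d1] and E = frobenius_dual_basisD[OF d2]
  define \<sigma> where "\<sigma> = (\<lambda>(i, j) x. \<rho> j (\<pi> i x))"
  define \<delta> where "\<delta> = (\<lambda>(i, j). \<gamma> j ^ (p ^ e) * \<beta> i)"
  have expand: "x = (\<Sum>k\<in>{..<n} \<times> {..<m}. \<sigma> k x ^ (p ^ Suc e) * \<delta> k)" if x: "x \<in> ?C" for x
  proof -
    have "x = (\<Sum>i<n. \<pi> i x ^ (p ^ e) * \<beta> i)"
      using D(6)[OF x] by simp
    also have "\<dots> = (\<Sum>i<n. \<Sum>j<m. \<rho> j (\<pi> i x) ^ (p ^ Suc e) * (\<gamma> j ^ (p ^ e) * \<beta> i))"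
    proof (rule sum.cong, simp)
      fix i assume i: "i \<in> {..<n}"
      have "\<pi> i x ^ (p ^ e) = (\<Sum>j<m. \<rho> j (\<pi> i x) ^ p * \<gamma> j) ^ (p ^ e)"
        using E(6)[OF D(3)[OF i x]] by simp
      also have "\<dots> = (\<Sum>j<m. \<rho> j (\<pi> i x) ^ (p ^ Suc e) * \<gamma> j ^ (p ^ e))"
        by (simp add: freshman_sum power_mult_distrib power_mult)
      finally have "\<pi> i x ^ (p ^ e) = (\<Sum>j<m. \<rho> j (\<pi> i x) ^ (p ^ Suc e) * \<gamma> j ^ (p ^ e))" .
      then show "\<pi> i x ^ (p ^ e) * \<beta> i = (\<Sum>j<m. \<rho> j (\<pi> i x) ^ (p ^ Suc e) * (\<gamma> j ^ (p ^ e) * \<beta> i))"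
        by (simp add: sum_distrib_right mult.assoc)
    qed
    also have "\<dots> = (\<Sum>k\<in>{..<n} \<times> {..<m}. \<sigma> k x ^ (p ^ Suc e) * \<delta> k)"
      by (simp add: sum.cartesian_product \<sigma>_def \<delta>_def case_prod_unfold)
    finally show ?thesis .
  qed
  have semilinear: "\<sigma> k (a ^ (p ^ Suc e) * x) = a * \<sigma> k x"
    if k: "k \<in> {..<n} \<times> {..<m}" and a: "a \<in> ?C" and x: "x \<in> ?C" for k a x
  proof -
    obtain i j where ij: "k = (i, j)" "i \<in> {..<n}" "j \<in> {..<m}" using k by auto
    have "\<pi> i ((a ^ p) ^ (p ^ e) * x) = a ^ p * \<pi> i x"
      by (rule D(5)[OF ij(2) carrier_closed(5)[OF a] x])
    then show ?thesis
      using E(5)[OF ij(3) a D(3)[OF ij(2) x]] by (simp add: \<sigma>_def ij power_mult)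
  qed
  have "frobenius_dual_basis ?C (p ^ Suc e) ({..<n} \<times> {..<m}) \<sigma> \<delta>"
    unfolding frobenius_dual_basis_def
  proof (intro conjI ballI)
    show "\<delta> k \<in> ?C" if "k \<in> {..<n} \<times> {..<m}" for k
      using that by (auto simp: \<delta>_def intro!: carrier_closed D(2) E(2))
    show "\<sigma> k x \<in> ?C" if "k \<in> {..<n} \<times> {..<m}" "x \<in> ?C" for k x
      using that by (auto simp: \<sigma>_def D(3) E(3))
    show "\<sigma> k (x + y) = \<sigma> k x + \<sigma> k y" if "k \<in> {..<n} \<times> {..<m}" "x \<in> ?C" "y \<in> ?C" for k x y
      using that by (auto simp: \<sigma>_def D(3,4) E(4))
  qed (use expand semilinear in auto)
  then show ?case by (rule frobenius_dual_basis_reindex)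
qed

section \<open>Frobenius powers of ideals\<close>

lemma ideal_frobenius_power: "J \<subseteq> carrier R \<Longrightarrow> ideal (frobenius_power R p e J) R"
  unfolding frobenius_power_def by (intro genideal_ideal) (auto intro: carrier_closed)

lemma frobenius_power_leI:
  "ideal A R \<Longrightarrow> (\<And>x. x \<in> J \<Longrightarrow> x ^ (p ^ e) \<in> A) \<Longrightarrow> frobenius_power R p e J \<subseteq> A"
  unfolding frobenius_power_def by (intro genideal_minimal) auto

lemma power_mem_frobenius_power:
  "J \<subseteq> carrier R \<Longrightarrow> x \<in> J \<Longrightarrow> x ^ (p ^ e) \<in> frobenius_power R p e J"
  unfolding frobenius_power_def
  by (rule subsetD[OF genideal_self]) (auto intro: carrier_closed)

text \<open>Forwards, the elements with all coordinates in \<open>J\<close> form an ideal containing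
  the generating powers. Backwards, the expansion along the \<open>\<beta> i\<close> exhibits
  \<open>x\<close> as a combination of such powers.\<close>

lemma mem_frobenius_power_iff:
  assumes D: "frobenius_dual_basis (carrier R) (p ^ e) I \<pi> \<beta>" and J: "ideal J R" and x: "x \<in> carrier R"
  shows "x \<in> frobenius_power R p e J \<longleftrightarrow> (\<forall>i\<in>I. \<pi> i x \<in> J)"
proof
  note D' = frobenius_dual_basisD[OF D] and JC = ideal_subset[OF J]
  let ?A = "{x \<in> carrier R. \<forall>i\<in>I. \<pi> i x \<in> J}"
  have \<pi>_zero: "\<pi> i 0 = 0" if "i \<in> I" for i
    using D'(4)[OF that carrier_closed(1) carrier_closed(1)] by simp
  have \<pi>_sum: "\<pi> i (sum g K) = (\<Sum>k\<in>K. \<pi> i (g k))"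
    if i: "i \<in> I" and "finite K" "\<And>k. k \<in> K \<Longrightarrow> g k \<in> carrier R" for i g and K :: "'b set"
    using that(2,3)
    by (induction K rule: finite_induct) (simp_all add: \<pi>_zero[OF i] D'(4)[OF i] sum_carrier)
  \<comment> \<open>The coordinates are not linear over \<open>R\<close>. Expanding
    \<open>x\<close>, but not \<open>c\<close>, leaves factors \<open>\<pi> j x ^ (p ^ e)\<close>,
    which pass through \<open>\<pi> i\<close> as \<open>\<pi> j x\<close>, an element of
    \<open>J\<close>.\<close>
  have mult: "\<pi> i (c * x) \<in> J" if c: "c \<in> carrier R" and x: "x \<in> ?A" and i: "i \<in> I" for c x i
  proof -
    have x': "x \<in> carrier R" "\<And>j. j \<in> I \<Longrightarrow> \<pi> j x \<in> J" using x by auto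
    have cC: "c * \<beta> j \<in> carrier R" if "j \<in> I" for j
      by (rule carrier_closed(4)[OF c D'(2)[OF that]])
    have "c * (\<Sum>j\<in>I. \<pi> j x ^ (p ^ e) * \<beta> j) = (\<Sum>j\<in>I. \<pi> j x ^ (p ^ e) * (c * \<beta> j))"
      by (simp add: sum_distrib_left mult.left_commute)
    then have "c * x = (\<Sum>j\<in>I. \<pi> j x ^ (p ^ e) * (c * \<beta> j))"
      by (simp only: D'(6)[OF x'(1)])
    then have "\<pi> i (c * x) = (\<Sum>j\<in>I. \<pi> i (\<pi> j x ^ (p ^ e) * (c * \<beta> j)))"
      using \<pi>_sum[OF i D'(1), of "\<lambda>j. \<pi> j x ^ (p ^ e) * (c * \<beta> j)"]
      by (simp add: carrier_closed(4,5) cC D'(3) x'(1))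
    also have "\<dots> = (\<Sum>j\<in>I. \<pi> j x * \<pi> i (c * \<beta> j))"
      by (intro sum.cong refl D'(5)[OF i D'(3) cC] x'(1))
    also have "\<dots> \<in> J"
    proof (rule ideal_sum[OF J])
      fix j assume j: "j \<in> I"
      show "\<pi> j x * \<pi> i (c * \<beta> j) \<in> J"
        using ideal_mult[OF J D'(3)[OF i cC[OF j]] x'(2)[OF j]] by (simp add: mult.commute)
    qed
    finally show ?thesis .
  qed
  have "ideal ?A R"
    unfolding ideal_iff
  proof (intro conjI ballI)
    show "0 \<in> ?A" by (simp add: carrier_closed(1) \<pi>_zero ideal_zero[OF J])
    show "x + y \<in> ?A" if "x \<in> ?A" "y \<in> ?A" for x y
      using that by (simp add: carrier_closed(3) D'(4) ideal_add[OF J])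
    show "c * x \<in> ?A" if "c \<in> carrier R" "x \<in> ?A" for c x
      using that mult[OF that] by (simp add: carrier_closed(4))
  qed auto
  moreover have "y ^ (p ^ e) \<in> ?A" if y: "y \<in> J" for y
  proof -
    have yC: "y \<in> carrier R" using y JC by auto
    have "\<pi> i (y ^ (p ^ e)) \<in> J" if i: "i \<in> I" for i
      using D'(5)[OF i yC carrier_closed(2)] ideal_mult[OF J D'(3)[OF i carrier_closed(2)] y]
      by (simp add: mult.commute)
    then show ?thesis by (simp add: carrier_closed(5) yC)
  qed
  ultimately have "frobenius_power R p e J \<subseteq> ?A" by (rule frobenius_power_leI)
  then show "\<forall>i\<in>I. \<pi> i x \<in> J" if "x \<in> frobenius_power R p e J" using that by auto
next
  note D' = frobenius_dual_basisD[OF D] and JC = ideal_subset[OF J]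
  note Q = ideal_frobenius_power[OF JC, of e]
  assume \<pi>: "\<forall>i\<in>I. \<pi> i x \<in> J"
  have "(\<Sum>i\<in>I. \<pi> i x ^ (p ^ e) * \<beta> i) \<in> frobenius_power R p e J"
  proof (rule ideal_sum[OF Q])
    fix i assume i: "i \<in> I"
    have "\<beta> i * \<pi> i x ^ (p ^ e) \<in> frobenius_power R p e J"
      by (rule ideal_mult[OF Q D'(2)[OF i] power_mem_frobenius_power[OF JC bspec[OF \<pi> i]]])
    then show "\<pi> i x ^ (p ^ e) * \<beta> i \<in> frobenius_power R p e J" by (simp add: mult.commute)
  qed
  then show "x \<in> frobenius_power R p e J" by (simp only: D'(6)[OF x])
qed

text \<open>By the coordinate test, an ideal is admissible in the definition of the root exactly
  when it contains the coordinates of \<open>g\<close>; this also shows that the least such ideal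
  exists.\<close>

lemma frobenius_root_eq_genideal:
  assumes D: "frobenius_dual_basis (carrier R) (p ^ e) I \<pi> \<beta>" and g: "g \<in> carrier R"
  shows "frobenius_root R p e g = Idl\<^bsub>R\<^esub> ((\<lambda>i. \<pi> i g) ` I)"
  unfolding frobenius_root_def
proof (rule Least_equality)
  have sub: "(\<lambda>i. \<pi> i g) ` I \<subseteq> carrier R"
    using D g by (auto simp: frobenius_dual_basis_def)
  then have Idl: "ideal (Idl\<^bsub>R\<^esub> ((\<lambda>i. \<pi> i g) ` I)) R" by (rule genideal_ideal)
  then show "ideal (Idl\<^bsub>R\<^esub> ((\<lambda>i. \<pi> i g) ` I)) R \<and> g \<in> frobenius_power R p e (Idl\<^bsub>R\<^esub> ((\<lambda>i. \<pi> i g) ` I))"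
    using genideal_self[OF sub] by (auto simp: mem_frobenius_power_iff[OF D Idl g])
  fix J assume J: "ideal J R \<and> g \<in> frobenius_power R p e J"
  then show "Idl\<^bsub>R\<^esub> ((\<lambda>i. \<pi> i g) ` I) \<subseteq> J"
    by (intro genideal_minimal) (auto simp: mem_frobenius_power_iff[OF D _ g])
qed

lemma frobenius_root_finitely_generated:
  assumes "g \<in> carrier R"
  shows "\<exists>S. finite S \<and> S \<subseteq> carrier R \<and> frobenius_root R p e g = Idl\<^bsub>R\<^esub> S"
proof -
  obtain n :: nat and \<pi> \<beta> where D: "frobenius_dual_basis (carrier R) (p ^ e) {..<n} \<pi> \<beta>"
    using dual_basis_power by blast
  then show ?thesis
    using assms frobenius_root_eq_genideal[OF D assms]
    by (intro exI[of _ "(\<lambda>i. \<pi> i g) ` {..<n}"]) (auto simp: frobenius_dual_basis_def)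
qed

lemma ideal_frobenius_root: "g \<in> carrier R \<Longrightarrow> ideal (frobenius_root R p e g) R"
  using frobenius_root_finitely_generated[of g e] genideal_ideal by metis

text \<open>The adjunction between roots and Frobenius powers. Several later identities between
  roots follow by comparing which ideals contain the two sides.\<close>

lemma frobenius_root_le_iff:
  assumes g: "g \<in> carrier R" and J: "ideal J R"
  shows "frobenius_root R p e g \<subseteq> J \<longleftrightarrow> g \<in> frobenius_power R p e J"
proof -
  obtain n :: nat and \<pi> \<beta> where D: "frobenius_dual_basis (carrier R) (p ^ e) {..<n} \<pi> \<beta>"
    using dual_basis_power by blast
  then have sub: "(\<lambda>i. \<pi> i g) ` {..<n} \<subseteq> carrier R"
    using g by (auto simp: frobenius_dual_basis_def)
  have "Idl\<^bsub>R\<^esub> ((\<lambda>i. \<pi> i g) ` {..<n}) \<subseteq> J \<longleftrightarrow> (\<lambda>i. \<pi> i g) ` {..<n} \<subseteq> J"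
    using genideal_minimal[OF J] genideal_self[OF sub] by blast
  then show ?thesis
    unfolding frobenius_root_eq_genideal[OF D g] mem_frobenius_power_iff[OF D J g] by auto
qed

lemma mem_frobenius_power_root: "g \<in> carrier R \<Longrightarrow> g \<in> frobenius_power R p e (frobenius_root R p e g)"
  using frobenius_root_le_iff[OF _ ideal_frobenius_root] by blast

lemma ideal_eqI:
  assumes "ideal A R" "ideal B R" "\<And>J. ideal J R \<Longrightarrow> A \<subseteq> J \<longleftrightarrow> B \<subseteq> J"
  shows "A = B"
  using assms by blast

lemma frobenius_power_add:
  assumes J: "ideal J R"
  shows "frobenius_power R p (d + e) J = frobenius_power R p d (frobenius_power R p e J)"
proof
  note JC = ideal_subset[OF J]
  note Qe = ideal_frobenius_power[OF JC, of e]
  note QeC = ideal_subset[OF Qe]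
  note Qde = ideal_frobenius_power[OF JC, of "d + e"]
  have "x ^ (p ^ (d + e)) = (x ^ (p ^ e)) ^ (p ^ d)" for x :: 'a
    by (simp add: power_add mult.commute flip: power_mult)
  note pow = this
  show "frobenius_power R p (d + e) J \<subseteq> frobenius_power R p d (frobenius_power R p e J)"
    by (intro frobenius_power_leI ideal_frobenius_power QeC)
      (auto simp: pow intro!: power_mem_frobenius_power JC QeC)
  \<comment> \<open>The preimage of an ideal under the ring endomorphism \<open>y ^ (p ^ d)\<close>
    is an ideal, so it suffices to test the generators \<open>x ^ (p ^ e)\<close>.\<close>
  let ?A = "{y \<in> carrier R. y ^ (p ^ d) \<in> frobenius_power R p (d + e) J}"
  have "ideal ?A R"
    using prime_gt_0_nat[OF prime_p] unfolding ideal_iff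
    by (auto simp: freshman power_mult_distrib zero_power intro!: carrier_closed ideal_zero[OF Qde] ideal_add[OF Qde] ideal_mult[OF Qde])
  moreover have "x ^ (p ^ e) \<in> ?A" if "x \<in> J" for x
    using that JC power_mem_frobenius_power[OF JC that, of "d + e"] by (auto simp: pow intro: carrier_closed)
  ultimately have "frobenius_power R p e J \<subseteq> ?A" by (rule frobenius_power_leI)
  then show "frobenius_power R p d (frobenius_power R p e J) \<subseteq> frobenius_power R p (d + e) J"
    by (intro frobenius_power_leI Qde) auto
qed

text \<open>Faithful flatness of Frobenius: the coordinates of \<open>1\<close> lie in the ideal \<open>(J : g)\<close>, whose
  Frobenius power therefore contains \<open>1\<close>.\<close>

lemma power_mem_frobenius_power_iff:
  assumes J: "ideal J R" and g: "g \<in> carrier R"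
  shows "g ^ (p ^ e) \<in> frobenius_power R p e J \<longleftrightarrow> g \<in> J"
proof
  assume *: "g ^ (p ^ e) \<in> frobenius_power R p e J"
  obtain n :: nat and \<pi> \<beta> where D: "frobenius_dual_basis (carrier R) (p ^ e) {..<n} \<pi> \<beta>"
    using dual_basis_power by blast
  let ?A = "{c \<in> carrier R. c * g \<in> J}"
  have A: "ideal ?A R"
    unfolding ideal_iff
    by (auto simp: distrib_right mult.assoc intro!: carrier_closed ideal_zero[OF J] ideal_add[OF J] ideal_mult[OF J])
  have "\<pi> i 1 \<in> ?A" if i: "i < n" for i
  proof -
    have "\<pi> i (g ^ (p ^ e) * 1) = g * \<pi> i 1" "\<pi> i 1 \<in> carrier R"
      using i frobenius_dual_basisD(5)[OF D _ g carrier_closed(2)] frobenius_dual_basisD(3)[OF D _ carrier_closed(2)]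
      by (simp_all del: mult_1_right)
    moreover have "\<pi> i (g ^ (p ^ e)) \<in> J"
      using * i mem_frobenius_power_iff[OF D J] g carrier_closed by auto
    ultimately show ?thesis by (simp add: mult.commute)
  qed
  then have "1 \<in> frobenius_power R p e ?A"
    using mem_frobenius_power_iff[OF D A carrier_closed(2)] by auto
  \<comment> \<open>The exponent \<open>p ^ e\<close> is positive, so the Frobenius power stays
    inside the ideal; hence \<open>1\<close> lies in \<open>?A\<close>, which says that
    \<open>g\<close> lies in \<open>J\<close>.\<close>
  moreover have "frobenius_power R p e ?A \<subseteq> ?A"
  proof (rule frobenius_power_leI[OF A])
    fix x assume x: "x \<in> ?A"
    obtain k where "p ^ e = Suc k"
      using prime_gt_0_nat[OF prime_p] by (metis gr0_conv_Suc zero_less_power)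
    then have "x ^ (p ^ e) = x ^ k * x" by simp
    then show "x ^ (p ^ e) \<in> ?A"
      using ideal_mult[OF A, of "x ^ k" x] x carrier_closed by auto
  qed
  ultimately show "g \<in> J" by auto
qed (simp add: power_mem_frobenius_power ideal_subset[OF J])

text \<open>By adjunction this reduces to cancelling the \<open>p ^ k\<close>-th Frobenius power,
  which \<open>power_mem_frobenius_power_iff\<close> permits.\<close>

lemma frobenius_root_add_power:
  assumes g: "g \<in> carrier R"
  shows "frobenius_root R p (k + e) (g ^ (p ^ k)) = frobenius_root R p e g"
proof (rule ideal_eqI)
  fix J assume J: "ideal J R"
  show "frobenius_root R p (k + e) (g ^ (p ^ k)) \<subseteq> J \<longleftrightarrow> frobenius_root R p e g \<subseteq> J"
    using g J
    by (simp add: frobenius_root_le_iff carrier_closed frobenius_power_add power_mem_frobenius_power_iff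
        ideal_frobenius_power ideal_subset)
qed (rule ideal_frobenius_root carrier_closed g)+

lemma frobenius_root_mult_mono:
  assumes "g \<in> carrier R" "h \<in> carrier R"
  shows "frobenius_root R p e (g * h) \<subseteq> frobenius_root R p e h"
proof -
  note r = ideal_frobenius_root[OF assms(2), of e]
  have "g * h \<in> frobenius_power R p e (frobenius_root R p e h)"
    by (rule ideal_mult[OF ideal_frobenius_power[OF ideal_subset[OF r]] assms(1) mem_frobenius_power_root[OF assms(2)]])
  then show ?thesis
    using assms r by (simp add: frobenius_root_le_iff carrier_closed)
qed

section \<open>Multiplication by \<open>f\<close> and two-stage roots\<close>

lemma ideal_image_mult:
  assumes J: "ideal J R" and f: "f \<in> carrier R"
  shows "ideal ((\<lambda>x. f * x) ` J) R"
  unfolding ideal_iff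
proof (intro conjI ballI)
  show "(\<lambda>x. f * x) ` J \<subseteq> carrier R" using ideal_subset[OF J] f by (auto intro: carrier_closed)
  show "0 \<in> (\<lambda>x. f * x) ` J" using ideal_zero[OF J] by (intro image_eqI[of _ _ 0]) auto
  show "x + y \<in> (\<lambda>x. f * x) ` J" if "x \<in> (\<lambda>x. f * x) ` J" "y \<in> (\<lambda>x. f * x) ` J" for x y
    using that by (auto simp: ideal_add[OF J] simp flip: distrib_left)
  show "c * x \<in> (\<lambda>x. f * x) ` J" if "c \<in> carrier R" "x \<in> (\<lambda>x. f * x) ` J" for c x
    using that by (auto simp: ideal_mult[OF J] mult.left_commute[of c])
qed

text \<open>Semilinearity turns the coordinates of \<open>f ^ (p ^ e) * g\<close> into
  \<open>f\<close> times those of \<open>g\<close>. This is the source of the periodicity of test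
  ideals.\<close>

lemma frobenius_root_power_mult:
  assumes f: "f \<in> carrier R" and g: "g \<in> carrier R"
  shows "frobenius_root R p e (f ^ (p ^ e) * g) = (\<lambda>x. f * x) ` frobenius_root R p e g"
proof
  obtain n :: nat and \<pi> \<beta> where D: "frobenius_dual_basis (carrier R) (p ^ e) {..<n} \<pi> \<beta>"
    using dual_basis_power by blast
  have fg: "f ^ (p ^ e) * g \<in> carrier R" using f g by (intro carrier_closed)
  let ?r = "frobenius_root R p e g" and ?r' = "frobenius_root R p e (f ^ (p ^ e) * g)"
  note r = ideal_frobenius_root[OF g, of e] and r' = ideal_frobenius_root[OF fg, of e]
  have \<pi>: "\<pi> i (f ^ (p ^ e) * g) = f * \<pi> i g" if "i < n" for i
    using D that f g by (simp add: frobenius_dual_basis_def)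
  have "\<pi> i (f ^ (p ^ e) * g) \<in> (\<lambda>x. f * x) ` ?r" if i: "i < n" for i
    using i \<pi> mem_frobenius_power_root[OF g, of e] mem_frobenius_power_iff[OF D r g] by auto
  then show "?r' \<subseteq> (\<lambda>x. f * x) ` ?r"
    unfolding frobenius_root_le_iff[OF fg ideal_image_mult[OF r f]]
      mem_frobenius_power_iff[OF D ideal_image_mult[OF r f] fg] by auto
  \<comment> \<open>For the reverse inclusion the colon ideal of \<open>?r'\<close> by
    \<open>f\<close> contains the coordinates of \<open>g\<close>, hence the whole root of
    \<open>g\<close>.\<close>
  let ?A = "{c \<in> carrier R. f * c \<in> ?r'}"
  have A: "ideal ?A R"
    unfolding ideal_iff
    by (auto simp: distrib_left mult.left_commute[of f] intro!: carrier_closed ideal_zero[OF r'] ideal_add[OF r'] ideal_mult[OF r'])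
  have "\<pi> i g \<in> ?A" if i: "i < n" for i
    using i \<pi>[OF i] frobenius_dual_basisD(3)[OF D _ g] mem_frobenius_power_root[OF fg, of e]
      mem_frobenius_power_iff[OF D r' fg]
    by (metis (mono_tags, lifting) lessThan_iff mem_Collect_eq)
  then have "?r \<subseteq> ?A"
    unfolding frobenius_root_le_iff[OF g A] mem_frobenius_power_iff[OF D A g] by auto
  then show "(\<lambda>x. f * x) ` ?r \<subseteq> ?r'" by auto
qed

text \<open>Take the root in two stages: the \<open>p ^ k\<close>-th root of
  \<open>f * g ^ (p ^ k)\<close> is \<open>g\<close> times the unit ideal, so only the
  \<open>p ^ e\<close>-th root of \<open>g\<close> remains. Thus an extra factor \<open>f\<close> is
  invisible at level \<open>k + e\<close>.\<close>

lemma frobenius_root_mult_power_of_root_eq: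
  assumes f: "f \<in> carrier R" and g: "g \<in> carrier R" and k: "frobenius_root R p k f = carrier R"
  shows "frobenius_root R p (k + e) (f * g ^ (p ^ k)) = frobenius_root R p e g"
proof (rule ideal_eqI)
  fix J assume J: "ideal J R"
  note Q = ideal_frobenius_power[OF ideal_subset[OF J], of e]
  have "f * g ^ (p ^ k) \<in> carrier R" using f g by (intro carrier_closed)
  then have "frobenius_root R p (k + e) (f * g ^ (p ^ k)) \<subseteq> J
    \<longleftrightarrow> frobenius_root R p k (g ^ (p ^ k) * f) \<subseteq> frobenius_power R p e J"
    using J Q by (simp add: frobenius_root_le_iff frobenius_power_add mult.commute)
  also have "\<dots> \<longleftrightarrow> g \<in> frobenius_power R p e J"
    using f g by (simp add: frobenius_root_power_mult k ideal_principal_le[OF Q])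
  finally show "frobenius_root R p (k + e) (f * g ^ (p ^ k)) \<subseteq> J \<longleftrightarrow> frobenius_root R p e g \<subseteq> J"
    using g J by (simp add: frobenius_root_le_iff)
qed (rule ideal_frobenius_root carrier_closed f g)+

text \<open>The inductive step for showing that roots of nonzero polynomials become the unit ideal.
  Splitting the Frobenius power into stages \<open>1\<close> and \<open>k\<close> puts
  \<open>\<pi> i f\<close> into \<open>frobenius_power R p k ?J\<close>, so the root of this
  coordinate lies in \<open>?J\<close>.\<close>

lemma root_eq_carrier_of_coordinate:
  assumes D: "frobenius_dual_basis (carrier R) p I \<pi> \<beta>" and i: "i \<in> I" and f: "f \<in> carrier R"
    and k: "frobenius_root R p k (\<pi> i f) = carrier R"
  shows "frobenius_root R p (1 + k) f = carrier R"
proof -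
  let ?J = "frobenius_root R p (1 + k) f"
  note J = ideal_frobenius_root[OF f, of "1 + k"]
  note Q = ideal_frobenius_power[OF ideal_subset[OF J], of k]
  have "f \<in> frobenius_power R p 1 (frobenius_power R p k ?J)"
    using mem_frobenius_power_root[OF f, of "1 + k"] frobenius_power_add[OF J, of 1 k] by simp
  then have "\<pi> i f \<in> frobenius_power R p k ?J"
    using mem_frobenius_power_iff[of 1 I \<pi> \<beta>, OF _ Q f] D i by simp
  then have "frobenius_root R p k (\<pi> i f) \<subseteq> ?J"
    using frobenius_root_le_iff[OF _ J] frobenius_dual_basisD(3)[OF D i f] by simp
  then show ?thesis
    using k ideal_subset[OF J] by auto
qed

lemma root_zero_eq_carrier_of_unit:
  assumes f: "f \<in> carrier R" and g: "g \<in> carrier R" "g * f = 1"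
  shows "frobenius_root R p 0 f = carrier R"
proof -
  let ?J = "frobenius_root R p 0 f"
  note J = ideal_frobenius_root[OF f, of 0]
  have "f \<in> ?J"
    using mem_frobenius_power_root[OF f, of 0] power_mem_frobenius_power_iff[OF J f, of 0] by simp
  then have "1 \<in> ?J"
    using ideal_mult[OF J g(1)] g(2) by metis
  then have "x \<in> ?J" if "x \<in> carrier R" for x
    using ideal_mult[OF J that, of 1] by simp
  then show ?thesis using ideal_subset[OF J] by auto
qed

end

section \<open>Test ideals and jumping numbers\<close>

lemma nat_ceiling_power_mult_le:
  assumes "p > 0"
  shows "nat \<lceil>real p ^ (d + e) * x\<rceil> \<le> p ^ d * nat \<lceil>real p ^ e * x\<rceil>"
proof -
  have "real p ^ d * (real p ^ e * x) \<le> real p ^ d * real (nat \<lceil>real p ^ e * x\<rceil>)"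
    by (intro mult_left_mono real_nat_ceiling_ge) simp
  then show ?thesis
    by (simp add: power_add mult.assoc)
qed

text \<open>A ceiling is determined by its integer upper bounds, and \<open>z \<le> n\<close> is the
  same as \<open>k * z \<le> k * n\<close>.\<close>

lemma ceiling_eq_of_ceiling_mult_eq:
  fixes x y :: real and k :: nat
  assumes k: "k > 0" and eq: "\<lceil>real k * x\<rceil> = \<lceil>real k * y\<rceil>"
  shows "\<lceil>x\<rceil> = \<lceil>y\<rceil>"
proof -
  have "\<lceil>z\<rceil> \<le> n \<longleftrightarrow> \<lceil>real k * z\<rceil> \<le> int k * n" for z n
    using k by (simp add: ceiling_le_iff)
  then have "\<lceil>x\<rceil> \<le> n \<longleftrightarrow> \<lceil>y\<rceil> \<le> n" for n
    using eq by metis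
  then show ?thesis by (meson order_antisym order_refl)
qed

context frobenius_ring
begin

lemma p_pos: "p > 0"
  by (rule prime_gt_0_nat[OF prime_p])

context
  fixes f assumes f: "f \<in> carrier R"
begin

section \<open>The ascending levels of a test ideal\<close>

lemma ideal_root_pow: "ideal (frobenius_root R p e (f ^ m)) R"
  by (intro ideal_frobenius_root carrier_closed f)

lemma root_pow_antimono:
  assumes "m \<le> m'"
  shows "frobenius_root R p e (f ^ m') \<subseteq> frobenius_root R p e (f ^ m)"
proof -
  have "f ^ m' = f ^ (m' - m) * f ^ m"
    using assms by (simp flip: power_add)
  then show ?thesis
    using frobenius_root_mult_mono[OF carrier_closed(5)[OF f] carrier_closed(5)[OF f]] by simp
qed

text \<open>Passing to level \<open>d + e\<close> with exponent \<open>p ^ d\<close> times the old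
  one changes nothing; rounding afresh there can only lower the exponent, so the root grows.\<close>

lemma root_pow_ceiling_mono:
  "frobenius_root R p e (f ^ nat \<lceil>real p ^ e * x\<rceil>) \<subseteq> frobenius_root R p (d + e) (f ^ nat \<lceil>real p ^ (d + e) * x\<rceil>)"
proof -
  have "frobenius_root R p e (f ^ nat \<lceil>real p ^ e * x\<rceil>)
      = frobenius_root R p (d + e) (f ^ (p ^ d * nat \<lceil>real p ^ e * x\<rceil>))"
    using frobenius_root_add_power[OF carrier_closed(5)[OF f], of d e "nat \<lceil>real p ^ e * x\<rceil>"]
    by (simp add: mult.commute flip: power_mult)
  also have "\<dots> \<subseteq> frobenius_root R p (d + e) (f ^ nat \<lceil>real p ^ (d + e) * x\<rceil>)"
    by (rule root_pow_antimono[OF nat_ceiling_power_mult_le[OF p_pos]])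
  finally show ?thesis .
qed

lemma root_pow_ceiling_le_test_ideal:
  "frobenius_root R p e (f ^ nat \<lceil>real p ^ e * x\<rceil>) \<subseteq> test_ideal R p f x"
proof -
  \<comment> \<open>The union in \<open>test_ideal\<close> starts at level 1; going up by one level
    covers level 0 as well.\<close>
  have "frobenius_root R p (1 + e) (f ^ nat \<lceil>real p ^ (1 + e) * x\<rceil>) \<subseteq> test_ideal R p f x"
    unfolding test_ideal_def nat_pow_eq by (rule UN_upper) simp
  then show ?thesis
    using root_pow_ceiling_mono[of e x 1] by blast
qed

text \<open>In an ascending union the first \<open>d\<close> levels may be discarded. The free
  \<open>d\<close> serves to skip rounding and to match shifted levels.\<close>

lemma test_ideal_le_iff:
  "test_ideal R p f x \<subseteq> J \<longleftrightarrow> (\<forall>e. frobenius_root R p (d + e) (f ^ nat \<lceil>real p ^ (d + e) * x\<rceil>) \<subseteq> J)"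
proof
  assume *: "\<forall>e. frobenius_root R p (d + e) (f ^ nat \<lceil>real p ^ (d + e) * x\<rceil>) \<subseteq> J"
  then have "frobenius_root R p e (f ^ nat \<lceil>real p ^ e * x\<rceil>) \<subseteq> J" for e
    using root_pow_ceiling_mono[of e x d] by blast
  then show "test_ideal R p f x \<subseteq> J"
    unfolding test_ideal_def nat_pow_eq by blast
qed (use root_pow_ceiling_le_test_ideal in blast)

text \<open>Finitely many memberships can be lifted to one common level. This serves both closure
  under addition and finite generating sets.\<close>

lemma finite_subset_test_ideal:
  assumes "finite S" "S \<subseteq> test_ideal R p f x"
  shows "\<exists>e. S \<subseteq> frobenius_root R p e (f ^ nat \<lceil>real p ^ e * x\<rceil>)"
  using assms
proof (induction S rule: finite_induct)
  case (insert a S)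
  then obtain e where e: "S \<subseteq> frobenius_root R p e (f ^ nat \<lceil>real p ^ e * x\<rceil>)" by auto
  obtain d where d: "a \<in> frobenius_root R p d (f ^ nat \<lceil>real p ^ d * x\<rceil>)"
    using insert.prems unfolding test_ideal_def nat_pow_eq by blast
  show ?case
    using e d root_pow_ceiling_mono[of e x d] root_pow_ceiling_mono[of d x e]
    by (intro exI[of _ "d + e"]) (auto simp: add.commute)
qed simp

lemma ideal_test_ideal: "ideal (test_ideal R p f x) R"
  unfolding ideal_iff
proof (intro conjI ballI)
  show "test_ideal R p f x \<subseteq> carrier R"
    using test_ideal_le_iff[of x "carrier R" 0] ideal_subset[OF ideal_root_pow] by simp
  show "0 \<in> test_ideal R p f x"
    using root_pow_ceiling_le_test_ideal[of 0 x] ideal_zero[OF ideal_root_pow] by blast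
  show "a + b \<in> test_ideal R p f x" if ab: "a \<in> test_ideal R p f x" "b \<in> test_ideal R p f x" for a b
  proof -
    obtain e where "{a, b} \<subseteq> frobenius_root R p e (f ^ nat \<lceil>real p ^ e * x\<rceil>)"
      using finite_subset_test_ideal[of "{a, b}" x] ab by auto
    then have "a + b \<in> frobenius_root R p e (f ^ nat \<lceil>real p ^ e * x\<rceil>)"
      by (intro ideal_add[OF ideal_root_pow]) auto
    then show ?thesis
      using root_pow_ceiling_le_test_ideal[of e x] by blast
  qed
  show "c * a \<in> test_ideal R p f x" if c: "c \<in> carrier R" and a: "a \<in> test_ideal R p f x" for c a
  proof -
    obtain e where "{a} \<subseteq> frobenius_root R p e (f ^ nat \<lceil>real p ^ e * x\<rceil>)"
      using finite_subset_test_ideal[of "{a}" x] a by blast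
    then have "c * a \<in> frobenius_root R p e (f ^ nat \<lceil>real p ^ e * x\<rceil>)"
      by (intro ideal_mult[OF ideal_root_pow c]) auto
    then show ?thesis
      using root_pow_ceiling_le_test_ideal[of e x] by blast
  qed
qed

lemma test_ideal_antimono:
  assumes "x \<le> y"
  shows "test_ideal R p f y \<subseteq> test_ideal R p f x"
proof -
  have "nat \<lceil>real p ^ e * x\<rceil> \<le> nat \<lceil>real p ^ e * y\<rceil>" for e
    using assms by (intro nat_mono ceiling_mono mult_left_mono) auto
  then show ?thesis
    unfolding test_ideal_def nat_pow_eq by (intro UN_mono root_pow_antimono) auto
qed

text \<open>From level \<open>e\<close> on no rounding occurs, so the chain is constant
  there.\<close>

lemma test_ideal_p_adic: "test_ideal R p f (real m / real p ^ e) = frobenius_root R p e (f ^ m)"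
proof -
  have "frobenius_root R p (e + d) (f ^ nat \<lceil>real p ^ (e + d) * (real m / real p ^ e)\<rceil>) = frobenius_root R p e (f ^ m)" for d
  proof -
    have "real p ^ (e + d) * (real m / real p ^ e) = real (m * p ^ d)"
      using p_pos by (simp add: power_add)
    then have "nat \<lceil>real p ^ (e + d) * (real m / real p ^ e)\<rceil> = m * p ^ d"
      by (metis ceiling_of_nat nat_int)
    then show ?thesis
      using frobenius_root_add_power[OF carrier_closed(5)[OF f], of d e m]
      by (simp add: power_mult add.commute)
  qed
  then have "test_ideal R p f (real m / real p ^ e) \<subseteq> J \<longleftrightarrow> frobenius_root R p e (f ^ m) \<subseteq> J" for J
    by (simp add: test_ideal_le_iff[of _ _ e])
  then show ?thesis by blast
qed

text \<open>Level \<open>e\<close> for \<open>real p * x\<close> and level \<open>1 + e\<close> for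
  \<open>x\<close> have the same exponent. In adjoint form this says that the test ideal at
  \<open>x\<close> is the \<open>p\<close>-th root of the one at \<open>p * x\<close>.\<close>

lemma test_ideal_p_mult_le_iff:
  assumes J: "ideal J R"
  shows "test_ideal R p f (real p * x) \<subseteq> frobenius_power R p 1 J \<longleftrightarrow> test_ideal R p f x \<subseteq> J"
proof -
  note Q = ideal_frobenius_power[OF ideal_subset[OF J], of 1]
  have "frobenius_root R p (0 + e) (f ^ nat \<lceil>real p ^ (0 + e) * (real p * x)\<rceil>) \<subseteq> frobenius_power R p 1 J
    \<longleftrightarrow> frobenius_root R p (1 + e) (f ^ nat \<lceil>real p ^ (1 + e) * x\<rceil>) \<subseteq> J" for e
    using J Q f frobenius_power_add[OF J, of e 1]
    by (simp add: frobenius_root_le_iff carrier_closed mult_ac)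
  then show ?thesis
    using test_ideal_le_iff[of "real p * x" "frobenius_power R p 1 J" 0] test_ideal_le_iff[of x J 1] by simp
qed

section \<open>Operations on jumping numbers\<close>

lemma F_jumping_number_p_mult:
  assumes "x \<in> F_jumping_numbers R p f"
  shows "real p * x \<in> F_jumping_numbers R p f"
proof (cases "x = 0")
  case False
  then have x: "x > 0" "\<And>\<epsilon>. 0 < \<epsilon> \<Longrightarrow> \<epsilon> < x \<Longrightarrow> test_ideal R p f x \<noteq> test_ideal R p f (x - \<epsilon>)"
    using assms by (auto simp: F_jumping_numbers_def)
  have "test_ideal R p f (real p * x) \<noteq> test_ideal R p f (real p * x - \<epsilon>)"
    if \<epsilon>: "0 < \<epsilon>" "\<epsilon> < real p * x" for \<epsilon>
  proof
    assume eq: "test_ideal R p f (real p * x) = test_ideal R p f (real p * x - \<epsilon>)"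
    \<comment> \<open>A constant stretch of length \<open>\<epsilon>\<close> below
      \<open>p * x\<close> pulls back to one of length \<open>\<epsilon> / p\<close> below
      \<open>x\<close>.\<close>
    have "real p * x - \<epsilon> = real p * (x - \<epsilon> / p)"
      using p_pos by (simp add: right_diff_distrib)
    then have "test_ideal R p f (x - \<epsilon> / p) \<subseteq> J \<longleftrightarrow> test_ideal R p f x \<subseteq> J" if "ideal J R" for J
      using test_ideal_p_mult_le_iff[OF that] eq by metis
    then have "test_ideal R p f x = test_ideal R p f (x - \<epsilon> / p)"
      by (intro ideal_eqI ideal_test_ideal) auto
    moreover have "0 < \<epsilon> / p" "\<epsilon> / p < x"
      using \<epsilon> p_pos by (simp_all add: field_simps)
    ultimately show False using x(2) by blast
  qed
  then show ?thesis
    using x p_pos by (auto simp: F_jumping_numbers_def)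
qed (simp add: F_jumping_numbers_def)

lemma F_jumping_number_p_power_mult:
  "x \<in> F_jumping_numbers R p f \<Longrightarrow> real p ^ k * x \<in> F_jumping_numbers R p f"
  by (induction k) (use F_jumping_number_p_mult in \<open>auto simp: mult.assoc\<close>)

text \<open>At each level the shift adds exactly \<open>p ^ e\<close> to the exponent, and
  \<open>f ^ (p ^ e)\<close> leaves the root as a factor \<open>f\<close>. Nonnegativity of
  \<open>x\<close> makes \<open>nat\<close> additive here.\<close>

lemma test_ideal_add_one:
  assumes "x \<ge> 0"
  shows "test_ideal R p f (x + 1) = (\<lambda>y. f * y) ` test_ideal R p f x"
proof -
  have "frobenius_root R p e (f ^ nat \<lceil>real p ^ e * (x + 1)\<rceil>)
      = (\<lambda>y. f * y) ` frobenius_root R p e (f ^ nat \<lceil>real p ^ e * x\<rceil>)" for e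
  proof -
    have "\<lceil>real p ^ e * (x + 1)\<rceil> = int (p ^ e) + \<lceil>real p ^ e * x\<rceil>"
      using ceiling_add_of_int[of "real p ^ e * x" "int (p ^ e)"] by (simp add: distrib_left)
    moreover have "0 \<le> \<lceil>real p ^ e * x\<rceil>"
      using assms by (smt (verit) ceiling_less_zero mult_nonneg_nonneg of_nat_0_le_iff zero_le_power)
    ultimately have "nat \<lceil>real p ^ e * (x + 1)\<rceil> = p ^ e + nat \<lceil>real p ^ e * x\<rceil>"
      by (simp add: nat_add_distrib nat_power_eq)
    then show ?thesis
      using frobenius_root_power_mult[OF f carrier_closed(5)[OF f]] by (simp add: power_add)
  qed
  then show ?thesis
    unfolding test_ideal_def nat_pow_eq by (simp only: image_UN)
qed

lemma F_jumping_number_minus_one: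
  assumes jump: "x + 1 \<in> F_jumping_numbers R p f" and x: "x > 0"
  shows "x \<in> F_jumping_numbers R p f"
proof -
  have "test_ideal R p f x \<noteq> test_ideal R p f (x - \<epsilon>)" if \<epsilon>: "0 < \<epsilon>" "\<epsilon> < x" for \<epsilon>
  proof
    assume "test_ideal R p f x = test_ideal R p f (x - \<epsilon>)"
    then have "test_ideal R p f (x + 1) = test_ideal R p f (x + 1 - \<epsilon>)"
      using test_ideal_add_one[of x] test_ideal_add_one[of "x - \<epsilon>"] \<epsilon> by (simp add: algebra_simps)
    then show False
      using jump \<epsilon> by (auto simp: F_jumping_numbers_def)
  qed
  then show ?thesis using x by (auto simp: F_jumping_numbers_def)
qed

text \<open>Subtract one \<open>\<lceil>x\<rceil> - 1\<close> times, staying positive throughout.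
  The resulting fractional part lies in \<open>(0, 1]\<close>: integers go to 1, not to 0.\<close>

lemma F_jumping_number_minus_ceiling:
  assumes jump: "x \<in> F_jumping_numbers R p f" and x: "x > 0"
  shows "x - of_int \<lceil>x\<rceil> + 1 \<in> F_jumping_numbers R p f"
proof -
  have "x - real k \<in> F_jumping_numbers R p f" if "real k < x" for k
    using that
  proof (induction k)
    case (Suc k)
    then show ?case using F_jumping_number_minus_one[of "x - real (Suc k)"] by simp
  qed (use jump in simp)
  moreover have "real (nat (\<lceil>x\<rceil> - 1)) = of_int \<lceil>x\<rceil> - 1"
    using x by simp
  moreover have "of_int \<lceil>x\<rceil> - 1 < x" by linarith
  ultimately have "x - (of_int \<lceil>x\<rceil> - 1) \<in> F_jumping_numbers R p f" by metis
  then show ?thesis by (simp add: algebra_simps)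
qed

text \<open>Finite generators all appear at one level \<open>e\<close>, so the test ideal is the
  root of some \<open>f ^ m\<close>. Since an extra factor \<open>f\<close> is invisible
  \<open>k\<close> levels further up, the ideal is unchanged at
  \<open>(m * p ^ k + 1) / p ^ (k + e)\<close>, which exceeds \<open>x\<close>.\<close>

lemma test_ideal_right_constant:
  assumes k: "frobenius_root R p k f = carrier R"
    and S: "finite S" "S \<subseteq> carrier R" "test_ideal R p f x = Idl\<^bsub>R\<^esub> S"
  shows "\<exists>y>x. test_ideal R p f y = test_ideal R p f x"
proof -
  obtain e where e: "S \<subseteq> frobenius_root R p e (f ^ nat \<lceil>real p ^ e * x\<rceil>)"
    using finite_subset_test_ideal[OF S(1), of x] genideal_self[OF S(2)] S(3) by auto
  define m where "m = nat \<lceil>real p ^ e * x\<rceil>"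
  have "frobenius_root R p e (f ^ m) = test_ideal R p f x"
    using genideal_minimal[OF ideal_root_pow e] root_pow_ceiling_le_test_ideal[of e x]
    by (simp add: S(3) m_def)
  moreover have "test_ideal R p f (real (m * p ^ k + 1) / real p ^ (k + e)) = frobenius_root R p e (f ^ m)"
    using frobenius_root_mult_power_of_root_eq[OF f carrier_closed(5)[OF f] k, of e m]
    unfolding test_ideal_p_adic by (simp add: power_mult)
  moreover have "x < real (m * p ^ k + 1) / real p ^ (k + e)"
  proof -
    have "real p ^ (k + e) * x = real p ^ k * (real p ^ e * x)"
      by (simp add: power_add)
    also have "\<dots> \<le> real p ^ k * real m"
      unfolding m_def by (intro mult_left_mono real_nat_ceiling_ge) simp
    also have "\<dots> < real (m * p ^ k + 1)"
      by simp
    finally show ?thesis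
      using p_pos by (simp add: pos_less_divide_eq mult.commute)
  qed
  ultimately show ?thesis by metis
qed

text \<open>The jumping number is the supremum \<open>\<xi>\<close> of the points where the test
  ideal still equals that at \<open>a\<close>. Right constancy shows that \<open>\<xi>\<close> is
  not such a point, so the ideal changes exactly there.\<close>

lemma ex_F_jumping_number:
  assumes k: "frobenius_root R p k f = carrier R"
    and a: "a = real m / real p ^ e" and neq: "test_ideal R p f a \<noteq> test_ideal R p f b"
    and ab: "a \<le> b"
  shows "\<exists>\<xi>\<in>F_jumping_numbers R p f. a < \<xi> \<and> \<xi> \<le> b"
proof -
  define E where "E = {x. a \<le> x \<and> test_ideal R p f x = test_ideal R p f a}"
  have a0: "a \<ge> 0" unfolding a by simp
  have aE: "a \<in> E" by (simp add: E_def)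
  have Eb: "x \<le> b" if "x \<in> E" for x
  proof (rule ccontr)
    assume "\<not> x \<le> b"
    then have "test_ideal R p f a \<subseteq> test_ideal R p f b"
      using that test_ideal_antimono[of b x] by (simp add: E_def)
    then show False using neq test_ideal_antimono[OF ab] by blast
  qed
  then have bdd: "bdd_above E" by (auto simp: bdd_above_def)
  define \<xi> where "\<xi> = Sup E"
  have le: "x \<le> \<xi>" if "x \<in> E" for x
    unfolding \<xi>_def by (rule cSup_upper[OF that bdd])
  have "\<xi> \<le> b"
    unfolding \<xi>_def by (rule cSup_least) (use aE Eb in auto)
  \<comment> \<open>Finite generation is available at the \<open>p\<close>-adic point
    \<open>a\<close>, and every point of \<open>E\<close> has this same ideal.\<close>
  obtain S where S: "finite S" "S \<subseteq> carrier R" "test_ideal R p f a = Idl\<^bsub>R\<^esub> S"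
    using frobenius_root_finitely_generated[OF carrier_closed(5)[OF f], of e m]
    unfolding a test_ideal_p_adic by blast
  have notin: "\<xi> \<notin> E"
  proof
    assume \<xi>: "\<xi> \<in> E"
    then obtain y where "y > \<xi>" "test_ideal R p f y = test_ideal R p f \<xi>"
      using test_ideal_right_constant[OF k S(1,2), of \<xi>] S(3) by (auto simp: E_def)
    then have "y \<in> E" using \<xi> by (simp add: E_def)
    then show False using le[of y] \<open>y > \<xi>\<close> by simp
  qed
  then have a\<xi>: "a < \<xi>"
    using le[OF aE] aE by (metis order_less_le)
  \<comment> \<open>Some point \<open>z\<close> of \<open>E\<close> lies above
    \<open>\<xi> - \<epsilon>\<close>; equality at both ends would squeeze the ideal at
    \<open>z\<close> and put \<open>\<xi>\<close> into \<open>E\<close>.\<close>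
  have "test_ideal R p f \<xi> \<noteq> test_ideal R p f (\<xi> - \<epsilon>)" if \<epsilon>: "0 < \<epsilon>" for \<epsilon>
  proof
    assume eq: "test_ideal R p f \<xi> = test_ideal R p f (\<xi> - \<epsilon>)"
    have "\<xi> - \<epsilon> < Sup E" using \<epsilon> by (simp add: \<xi>_def)
    then obtain z where z: "z \<in> E" "\<xi> - \<epsilon> < z"
      using less_cSup_iff[OF _ bdd] aE by blast
    then have "test_ideal R p f z = test_ideal R p f \<xi>"
      using eq test_ideal_antimono[of z \<xi>] test_ideal_antimono[of "\<xi> - \<epsilon>" z] le[OF z(1)] by auto
    then have "\<xi> \<in> E"
      using z(1) a\<xi> by (simp add: E_def)
    then show False using notin by simp
  qed
  then have "\<xi> \<in> F_jumping_numbers R p f"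
    using a\<xi> a0 by (auto simp: F_jumping_numbers_def)
  then show ?thesis using a\<xi> \<open>\<xi> \<le> b\<close> by blast
qed

text \<open>The fractional part in \<open>(0, 1]\<close> of \<open>p\<^sup>u\<^sup>+\<^sup>v\<^sup>j \<alpha>\<close> does not depend on \<open>j\<close>, and by the hypothesis on
  ceilings that of \<open>p\<^sup>u\<^sup>+\<^sup>v\<^sup>j \<mu>\<close> differs from it by exactly \<open>p\<^sup>u\<^sup>+\<^sup>v\<^sup>j (\<mu> - \<alpha>)\<close>.\<close>

lemma F_jumping_number_eq_of_ceiling_eq:
  assumes fin: "finite (F_jumping_numbers R p f \<inter> {0..<1})"
    and card: "card (F_jumping_numbers R p f \<inter> {0..<1}) \<le> B"
    and int: "real p ^ u * (real p ^ v - 1) * \<alpha> \<in> \<int>" and v: "v > 0"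
    and \<mu>: "\<mu> \<in> F_jumping_numbers R p f" "\<mu> > 0"
    and ceil: "\<lceil>real p ^ (u + v * B) * \<mu>\<rceil> = \<lceil>real p ^ (u + v * B) * \<alpha>\<rceil>"
  shows "\<mu> = \<alpha>"
proof (rule ccontr)
  assume neq: "\<mu> \<noteq> \<alpha>"
  let ?J = "F_jumping_numbers R p f"
  define c where "c = (\<lambda>j y. real p ^ (u + v * j) * y - of_int \<lceil>real p ^ (u + v * j) * y\<rceil> + 1)"
  have c_alpha: "c j \<alpha> = c 0 \<alpha>" for j
  proof (induction j)
    case (Suc j)
    have "real p ^ (v * j) * (real p ^ u * (real p ^ v - 1) * \<alpha>) \<in> \<int>"
      by (intro Ints_mult Ints_power Ints_of_nat int)
    then obtain z where z: "real p ^ (v * j) * (real p ^ u * (real p ^ v - 1) * \<alpha>) = of_int z"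
      by (auto elim: Ints_cases)
    \<comment> \<open>Consecutive multiples differ by \<open>p ^ (v * j)\<close> times the integer
      from \<open>int\<close>, so their fractional parts agree.\<close>
    have "real p ^ (u + v * Suc j) * \<alpha> = real p ^ (u + v * j) * \<alpha> + of_int z"
      unfolding z[symmetric] by (simp add: power_add algebra_simps)
    then show ?case using Suc.IH by (simp add: c_def)
  qed simp
  have c_mu: "c j \<mu> = c 0 \<alpha> + real p ^ (u + v * j) * (\<mu> - \<alpha>)" if j: "j \<le> B" for j
  proof -
    have split: "u + v * B = v * (B - j) + (u + v * j)"
    proof -
      have "v * B = v * (B - j) + v * j"
        using j by (simp flip: distrib_left)
      then show ?thesis by simp
    qed
    \<comment> \<open>Equality of ceilings at the finest scale \<open>j = B\<close> descends to all
      coarser scales.\<close>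
    have "\<lceil>real p ^ (u + v * j) * \<mu>\<rceil> = \<lceil>real p ^ (u + v * j) * \<alpha>\<rceil>"
    proof (rule ceiling_eq_of_ceiling_mult_eq)
      show "p ^ (v * (B - j)) > 0" using p_pos by simp
      have "real p ^ (u + v * B) = real (p ^ (v * (B - j))) * real p ^ (u + v * j)"
        unfolding split by (simp add: power_add)
      then show "\<lceil>real (p ^ (v * (B - j))) * (real p ^ (u + v * j) * \<mu>)\<rceil>
          = \<lceil>real (p ^ (v * (B - j))) * (real p ^ (u + v * j) * \<alpha>)\<rceil>"
        using ceil by (simp only: mult.assoc)
    qed
    then have "c j \<mu> = c j \<alpha> + real p ^ (u + v * j) * (\<mu> - \<alpha>)"
      by (simp only: c_def right_diff_distrib)
    then show ?thesis using c_alpha[of j] by simp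
  qed
  have inj: "inj_on (\<lambda>j. c j \<mu>) {..B}"
  proof (rule inj_onI)
    fix i j assume ij: "i \<in> {..B}" "j \<in> {..B}" "c i \<mu> = c j \<mu>"
    then have "real p ^ (u + v * i) = real p ^ (u + v * j)"
      using neq by (simp add: c_mu)
    moreover have "real p > 1" using prime_gt_1_nat[OF prime_p] by simp
    ultimately have "u + v * i = u + v * j" by (meson power_inject_exp)
    then show "i = j" using v by simp
  qed
  \<comment> \<open>The values are positive, so inside \<open>[0, 1)\<close> they avoid the jumping
    number 0; the value 1 takes its place in the count. This leaves at most \<open>B\<close>
    possibilities for \<open>B + 1\<close> distinct values.\<close>
  have sub: "(\<lambda>j. c j \<mu>) ` {..B} \<subseteq> insert 1 (?J \<inter> {0..<1} - {0})"
  proof (rule image_subsetI)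
    fix j
    have "c j \<mu> \<in> ?J"
      unfolding c_def
      by (intro F_jumping_number_minus_ceiling F_jumping_number_p_power_mult \<mu>) (use p_pos \<mu> in simp)
    moreover have "0 < c j \<mu>" "c j \<mu> \<le> 1"
      unfolding c_def by linarith+
    ultimately show "c j \<mu> \<in> insert 1 (?J \<inter> {0..<1} - {0})" by auto
  qed
  have "Suc B = card ((\<lambda>j. c j \<mu>) ` {..B})"
    by (simp add: card_image[OF inj])
  also have "\<dots> \<le> card (insert 1 (?J \<inter> {0..<1} - {0}))"
    by (rule card_mono[OF _ sub]) (use fin in simp)
  also have "\<dots> \<le> Suc (card (?J \<inter> {0..<1} - {0}))"
    by (rule card_insert_le_m1) simp_all
  also have "\<dots> = card (?J \<inter> {0..<1})"
    by (rule card_Suc_Diff1[OF fin]) (simp add: F_jumping_numbers_def)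
  finally show False using card by simp
qed

lemma F_jumping_number_iff_truncation:
  assumes reg: "f = 0 \<or> (\<exists>k. frobenius_root R p k f = carrier R)"
    and fin: "finite (F_jumping_numbers R p f \<inter> {0..<1})"
    and card: "card (F_jumping_numbers R p f \<inter> {0..<1}) \<le> B"
    and int: "real p ^ u * (real p ^ v - 1) * \<alpha> \<in> \<int>" and v: "v > 0"
    and s: "s = u + v * B" and large: "real p ^ s * \<alpha> > 1"
  shows "\<alpha> \<in> F_jumping_numbers R p f \<longleftrightarrow>
      test_ideal R p f (truncation p s \<alpha>) \<noteq> test_ideal R p f (truncation p s \<alpha> + 1 / real p ^ s)"
    and "test_ideal R p f (truncation p s \<alpha>) = frobenius_root R p s (f ^ nat (\<lceil>real p ^ s * \<alpha>\<rceil> - 1))"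
    and "test_ideal R p f (truncation p s \<alpha> + 1 / real p ^ s) = frobenius_root R p s (f ^ nat \<lceil>real p ^ s * \<alpha>\<rceil>)"
proof -
  define M where "M = \<lceil>real p ^ s * \<alpha>\<rceil>"
  let ?a = "truncation p s \<alpha>" and ?b = "truncation p s \<alpha> + 1 / real p ^ s"
  have ps: "real p ^ s > 0" using p_pos by simp
  \<comment> \<open>Hence both exponents \<open>M - 1\<close> and \<open>M\<close> are positive: the
    truncation is above 0, and for \<open>f = 0\<close> the two powers coincide.\<close>
  have M1: "M > 1" using large by (simp add: M_def)
  have a: "?a = real (nat (M - 1)) / real p ^ s"
    using M1 by (simp add: truncation_def M_def)
  have b: "?b = real (nat M) / real p ^ s"
    using M1 ps by (simp add: truncation_def M_def diff_divide_distrib)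
  show "test_ideal R p f ?a = frobenius_root R p s (f ^ nat (\<lceil>real p ^ s * \<alpha>\<rceil> - 1))"
    unfolding a test_ideal_p_adic by (simp add: M_def)
  show "test_ideal R p f ?b = frobenius_root R p s (f ^ nat \<lceil>real p ^ s * \<alpha>\<rceil>)"
    unfolding b test_ideal_p_adic by (simp add: M_def)
  \<comment> \<open>The half-open interval between the truncations is exactly the set of points with
    the same ceiling as \<open>\<alpha>\<close> at level \<open>s\<close>.\<close>
  have interval: "?a < x \<and> x \<le> ?b \<longleftrightarrow> \<lceil>real p ^ s * x\<rceil> = M" for x
  proof -
    have "?a < x \<and> x \<le> ?b \<longleftrightarrow> of_int M - 1 < real p ^ s * x \<and> real p ^ s * x \<le> of_int M"
      unfolding b using M1 ps by (subst a) (simp add: pos_divide_less_eq pos_le_divide_eq mult.commute)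
    then show ?thesis by (simp add: ceiling_eq_iff)
  qed
  have a0: "?a > 0" unfolding a using M1 ps by simp
  have \<alpha>: "?a < \<alpha>" "\<alpha> \<le> ?b" using interval[of \<alpha>] by (simp_all add: M_def)
  show "\<alpha> \<in> F_jumping_numbers R p f \<longleftrightarrow> test_ideal R p f ?a \<noteq> test_ideal R p f ?b"
  proof
    assume "\<alpha> \<in> F_jumping_numbers R p f"
    then have "\<forall>\<epsilon>. 0 < \<epsilon> \<and> \<epsilon> < \<alpha> \<longrightarrow> test_ideal R p f \<alpha> \<noteq> test_ideal R p f (\<alpha> - \<epsilon>)"
      using \<alpha> a0 by (auto simp: F_jumping_numbers_def)
    \<comment> \<open>This difference is an admissible \<open>\<epsilon>\<close> because
      \<open>?a\<close> lies strictly between 0 and \<open>\<alpha>\<close>.\<close>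
    from this[rule_format, of "\<alpha> - ?a"] have "test_ideal R p f \<alpha> \<noteq> test_ideal R p f ?a"
      using \<alpha> a0 by simp
    then show "test_ideal R p f ?a \<noteq> test_ideal R p f ?b"
      using test_ideal_antimono[of ?a \<alpha>] test_ideal_antimono[of \<alpha> ?b] \<alpha> by auto
  next
    assume neq: "test_ideal R p f ?a \<noteq> test_ideal R p f ?b"
    show "\<alpha> \<in> F_jumping_numbers R p f"
    proof (cases "f = 0")
      case True
      then have "f ^ nat (M - 1) = f ^ nat M" using M1 by (simp add: power_0_left)
      then show ?thesis using neq a b by (metis test_ideal_p_adic)
    next
      case False
      then obtain k where "frobenius_root R p k f = carrier R" using reg by blast
      then obtain \<mu> where \<mu>: "\<mu> \<in> F_jumping_numbers R p f" "?a < \<mu>" "\<mu> \<le> ?b"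
        using ex_F_jumping_number[OF _ a neq] \<alpha> by auto
      have "\<mu> = \<alpha>"
        by (rule F_jumping_number_eq_of_ceiling_eq[OF fin card int v \<mu>(1)])
          (use \<mu> a0 interval in \<open>auto simp: M_def s\<close>)
      then show ?thesis using \<mu> by simp
    qed
  qed
qed

end

end

section \<open>Minimal exponent pairs\<close>

text \<open>Gives the uniqueness required by the definite description in
  \<open>minimal_exponent_pair\<close>.\<close>

lemma prime_powi_fraction_unique:
  fixes m n m' n' :: nat
  assumes p: "prime p"
    and m: "m > 0" "n > 0" "coprime p m" "coprime p n" "coprime m n"
    and m': "m' > 0" "n' > 0" "coprime p m'" "coprime p n'" "coprime m' n'"
    and eq: "real p powi \<nu> * (real m / real n) = real p powi \<nu>' * (real m' / real n')"
  shows "\<nu> = \<nu>' \<and> m = m' \<and> n = n'"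
proof -
  \<comment> \<open>Applied in both directions. A larger exponent on the left would make
    \<open>p\<close> divide \<open>m' * n\<close>, against coprimality.\<close>
  have le: "\<nu> \<le> \<nu>'"
    if m: "m > 0" "n > 0" "coprime p m" "coprime p n"
      and m': "m' > 0" "n' > 0" "coprime p m'" "coprime p n'"
      and eq: "real p powi \<nu> * (real m / real n) = real p powi \<nu>' * (real m' / real n')"
    for m n m' n' :: nat and \<nu> \<nu>'
  proof (rule ccontr)
    assume "\<not> \<nu> \<le> \<nu>'"
    define d where "d = nat (\<nu> - \<nu>')"
    have d: "\<nu> = \<nu>' + int d" "d > 0" using \<open>\<not> \<nu> \<le> \<nu>'\<close> by (auto simp: d_def)
    have p0: "real p > 0" using prime_gt_0_nat[OF p] by simp
    have "real p powi \<nu> = real p powi \<nu>' * real p ^ d"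
      using p0 by (simp add: d power_int_add)
    then have "real p powi \<nu>' * (real p ^ d * (real m / real n)) = real p powi \<nu>' * (real m' / real n')"
      using eq by (simp add: mult.assoc)
    then have "real p ^ d * (real m / real n) = real m' / real n'"
      using p0 by (subst (asm) mult_cancel_left) simp
    then have "real (p ^ d * m * n') = real (m' * n)"
      using m m' by (simp add: field_simps)
    then have "p ^ d * m * n' = m' * n" by (simp only: of_nat_eq_iff)
    moreover have "p dvd p ^ d * m * n'" using d(2) by simp
    ultimately have "p dvd m' * n" by simp
    then have "p dvd m' \<or> p dvd n" using p by (simp add: prime_dvd_mult_iff)
    then show False using m' m p
      by (metis coprime_absorb_left not_prime_unit)
  qed
  have \<nu>: "\<nu> = \<nu>'"
    using le[OF m(1-4) m'(1-4) eq] le[OF m'(1-4) m(1-4) eq[symmetric]] by simp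
  then have "real m / real n = real m' / real n'"
    using eq prime_gt_0_nat[OF p] by (metis mult_left_cancel of_nat_0_less_iff order_less_irrefl power_int_not_zero)
  then have "real (m * n') = real (m' * n)"
    using m m' by (simp add: field_simps)
  then have mn: "m * n' = m' * n" by (simp only: of_nat_eq_iff)
  have "n dvd n'" using m(5) mn by (metis coprime_commute coprime_dvd_mult_right_iff dvd_triv_right)
  moreover have "n' dvd n" using m'(5) mn by (metis coprime_commute coprime_dvd_mult_right_iff dvd_triv_right)
  ultimately have "n = n'" by (rule dvd_antisym)
  then show ?thesis using \<nu> mn m(2) by simp
qed

lemma ex_prime_powi_fraction:
  assumes p: "prime p" and \<alpha>: "\<alpha> \<in> \<rat>" "\<alpha> > 0"
  shows "\<exists>(\<nu>::int) (m::nat) (n::nat). m > 0 \<and> n > 0 \<and> coprime p m \<and> coprime p n \<and> coprime m n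
    \<and> \<alpha> = real p powi \<nu> * (real m / real n)"
proof -
  obtain a b :: nat where ab: "b \<noteq> 0" "\<bar>\<alpha>\<bar> = real a / real b" "coprime a b"
    using Rats_abs_nat_div_natE[OF \<alpha>(1)] by blast
  then have a: "a > 0" using \<alpha>(2) by (cases "a = 0") auto
  obtain i m where m: "\<not> p dvd m" "a = m * p ^ i" using prime_power_canonical[OF p a] by blast
  obtain j n where n: "\<not> p dvd n" "b = n * p ^ j" using prime_power_canonical[OF p, of b] ab(1) by blast
  have "\<alpha> = real p powi (int i - int j) * (real m / real n)"
    using ab \<alpha>(2) m n prime_gt_0_nat[OF p] by (simp add: power_int_diff field_simps)
  moreover have "m > 0" "n > 0" using a ab m n by (auto intro: Nat.gr0I)
  moreover have "coprime p m" "coprime p n" using m n p by (auto intro: prime_imp_coprime)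
  moreover have "coprime m n" using ab(3) m n by auto
  ultimately show ?thesis by blast
qed

text \<open>The factor \<open>p ^ u\<close> clears a negative power of \<open>p\<close>, and
  \<open>p ^ v - 1\<close> is a multiple of the denominator \<open>n\<close>.\<close>

lemma minimal_exponent_pairD:
  assumes p: "prime p" and \<alpha>: "\<alpha> \<in> \<rat>" "\<alpha> > 0" and uv: "minimal_exponent_pair p \<alpha> = (u, v)"
  shows "v > 0" and "real p ^ u * (real p ^ v - 1) * \<alpha> \<in> \<int>"
proof -
  obtain \<nu> :: int and m n :: nat where mn: "m > 0" "n > 0" "coprime p m" "coprime p n" "coprime m n"
    and eq: "\<alpha> = real p powi \<nu> * (real m / real n)"
    using ex_prime_powi_fraction[OF p \<alpha>] by blast
  have "minimal_exponent_pair p \<alpha> = (nat (max (- \<nu>) 0), LEAST t. t \<ge> 1 \<and> [p ^ t = 1] (mod n))"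
    unfolding minimal_exponent_pair_def
  proof (rule the_equality)
    fix uv
    assume "\<exists>(\<nu>'::int) (m'::nat) (n'::nat). m' > 0 \<and> n' > 0 \<and> coprime p m' \<and> coprime p n' \<and> coprime m' n'
      \<and> \<alpha> = real p powi \<nu>' * (real m' / real n')
      \<and> uv = (nat (max (- \<nu>') 0), LEAST t. t \<ge> 1 \<and> [p ^ t = 1] (mod n'))"
    then obtain \<nu>' :: int and m' n' :: nat where mn': "m' > 0" "n' > 0" "coprime p m'" "coprime p n'" "coprime m' n'"
      and eq': "\<alpha> = real p powi \<nu>' * (real m' / real n')"
      and uv: "uv = (nat (max (- \<nu>') 0), LEAST t. t \<ge> 1 \<and> [p ^ t = 1] (mod n'))" by blast
    have "\<nu> = \<nu>' \<and> m = m' \<and> n = n'"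
      using prime_powi_fraction_unique[OF p mn mn'] eq eq' by metis
    then show "uv = (nat (max (- \<nu>) 0), LEAST t. t \<ge> 1 \<and> [p ^ t = 1] (mod n))"
      unfolding uv by simp
  qed (use mn eq in blast)
  then have u: "u = nat (max (- \<nu>) 0)" and v: "v = (LEAST t. t \<ge> 1 \<and> [p ^ t = 1] (mod n))"
    using uv by auto
  \<comment> \<open>By Euler's theorem the totient qualifies, so the least exponent is
    attained.\<close>
  have "1 \<le> totient n \<and> [p ^ totient n = 1] (mod n)"
    using mn euler_theorem[of p n] by (simp add: Suc_le_eq)
  then have v': "1 \<le> v" "[p ^ v = 1] (mod n)"
    unfolding v using LeastI[of "\<lambda>t. t \<ge> 1 \<and> [p ^ t = 1] (mod n)"] by blast+
  show "v > 0" using v' by simp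
  obtain k where k: "p ^ v - 1 = n * k"
    using v'(2) by (metis cong_altdef_nat dvdE one_le_power prime_ge_1_nat p)
  have p0: "real p > 0" using prime_gt_0_nat[OF p] by simp
  have "real p ^ v - 1 = real (p ^ v - 1)"
    using prime_ge_1_nat[OF p] by simp
  then have 1: "real p ^ v - 1 = real n * real k" unfolding k by simp
  have "real p ^ u * real p powi \<nu> = real p powi (int u + \<nu>)"
    using p0 by (simp add: power_int_add)
  \<comment> \<open>By the choice of \<open>u\<close> the exponent is nonnegative, so
    \<open>nat\<close> loses nothing.\<close>
  also have "\<dots> = real p ^ nat (int u + \<nu>)"
    by (simp add: power_int_def u)
  finally have 2: "real p ^ u * real p powi \<nu> = real p ^ nat (int u + \<nu>)" .
  have "real p ^ u * (real p ^ v - 1) * \<alpha> = (real p ^ u * real p powi \<nu>) * real k * real m"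
    unfolding eq 1 using mn by simp
  then have "real p ^ u * (real p ^ v - 1) * \<alpha> = of_int (int (p ^ nat (int u + \<nu>) * k * m))"
    unfolding 2 by simp
  then show "real p ^ u * (real p ^ v - 1) * \<alpha> \<in> \<int>"
    by (metis Ints_of_int)
qed

text \<open>A positive natural number is at least 1, and replacing \<open>p ^ b - 1\<close> by
  \<open>p ^ b\<close> makes the inequality strict.\<close>

lemma bounded_rationals_power_mult_gt_one:
  assumes p: "p > 1" and \<alpha>: "\<alpha> \<in> bounded_rationals p B" "\<alpha> > 0"
  shows "real p ^ B * \<alpha> > 1"
proof -
  obtain a b where ab: "b > 0" "real p ^ a * (real p ^ b - 1) * \<alpha> \<in> \<nat>" "a + b \<le> B"
    using \<alpha> by (auto simp: bounded_rationals_def exponent_pairs_def)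
  have "real p ^ b > 1" using p ab(1) by simp
  then have "real p ^ a * (real p ^ b - 1) * \<alpha> > 0" using p \<alpha>(2) by simp
  then have "1 \<le> real p ^ a * (real p ^ b - 1) * \<alpha>"
    using ab(2) by (auto elim!: Nats_cases)
  also have "\<dots> < real p ^ a * real p ^ b * \<alpha>" using p \<alpha>(2) by simp
  also have "\<dots> \<le> real p ^ B * \<alpha>"
    using p \<alpha>(2) ab(3) by (intro mult_right_mono) (simp_all flip: power_add)
  finally show ?thesis .
qed

section \<open>F-finite fields\<close>

text \<open>Turns iterated line extensions into sums: each extension contributes one vector, stored
  at the next index.\<close>

lemma dimension_type_ring_imp_sum:
  fixes K E :: "'a::comm_ring_1 set"
  assumes "ring.dimension (ring_of_type_algebra :: 'a ring) n K E"
  shows "\<exists>b. \<forall>x\<in>E. \<exists>c. (\<forall>i<n. c i \<in> K) \<and> x = (\<Sum>i<n. c i * b i)"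
proof -
  interpret L: ring "ring_of_type_algebra :: 'a ring" by (rule ring_from_type_algebra)
  show ?thesis
    using assms
  proof (induction rule: L.dimension.induct)
    case (zero_dim K)
    then show ?case by (simp add: ring_of_type_algebra_def)
  next
    case (Suc_dim v E n K)
    then obtain b where b: "\<forall>x\<in>E. \<exists>c. (\<forall>i<n. c i \<in> K) \<and> x = (\<Sum>i<n. c i * b i)" by blast
    have "\<exists>c. (\<forall>i<Suc n. c i \<in> K) \<and> x = (\<Sum>i<Suc n. c i * (b(n := v)) i)"
      if x: "x \<in> L.line_extension K v E" for x
    proof -
      obtain k y where k: "k \<in> K" "y \<in> E" "x = k * v + y"
        using x unfolding L.line_extension_mem_iff by (auto simp: ring_of_type_algebra_def)
      obtain c where c: "\<forall>i<n. c i \<in> K" "y = (\<Sum>i<n. c i * b i)" using b k by blast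
      have "x = (\<Sum>i<Suc n. (c(n := k)) i * (b(n := v)) i)"
        using k c by (simp add: add.commute)
      then show ?thesis
        using k c by (intro exI[of _ "c(n := k)"]) (auto simp: less_Suc_eq)
    qed
    then show ?case by blast
  qed
qed

text \<open>A spanning family of least size is independent, so coordinates are unique; uniqueness
  then forces additivity and semilinearity.\<close>

lemma F_finite_imp_dual_basis:
  assumes p: "CHAR('k::field) = p" "p > 0" and F: "F_finite (ring_of_type_algebra :: 'k ring) p"
  shows "\<exists>(n::nat) \<pi> \<beta>. frobenius_dual_basis (UNIV :: 'k set) p {..<n} \<pi> \<beta>"
proof -
  interpret L: ring "ring_of_type_algebra :: 'k ring" by (rule ring_from_type_algebra)
  have prime: "prime p"
    using p prime_CHAR_semidom[where ?'a = 'k] by simp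
  have fresh: "(x + y) ^ p = x ^ p + y ^ p" for x y :: 'k
    by (rule freshmans_dream) (use p(1) prime in simp_all)
  have pow: "x [^]\<^bsub>ring_of_type_algebra\<^esub> (m::nat) = x ^ m" for x :: 'k and m
    by (induction m) (simp_all add: ring_of_type_algebra_def mult.commute nat_pow_def)
  define spans where "spans = (\<lambda>(b :: nat \<Rightarrow> 'k) I. \<forall>x. \<exists>c. x = (\<Sum>i\<in>I. c i ^ p * b i))"
  obtain n where n: "L.dimension n (range (\<lambda>x::'k. x ^ p)) UNIV"
    using F by (auto simp: F_finite_def L.finite_dimension_def pow) (simp add: ring_of_type_algebra_def)
  obtain b where b: "\<forall>x\<in>UNIV. \<exists>c. (\<forall>i<n. c i \<in> range (\<lambda>x::'k. x ^ p)) \<and> x = (\<Sum>i<n. c i * b i)"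
    using dimension_type_ring_imp_sum[OF n] by blast
  have "spans b {..<n}"
    unfolding spans_def
  proof
    fix x
    obtain c where c: "\<forall>i<n. c i \<in> range (\<lambda>x::'k. x ^ p)" "x = (\<Sum>i<n. c i * b i)" using b by blast
    then have "\<forall>i. \<exists>d. i < n \<longrightarrow> c i = d ^ p" by auto
    then obtain d where "\<forall>i. i < n \<longrightarrow> c i = d i ^ p" by metis
    then have "x = (\<Sum>i<n. d i ^ p * b i)" using c(2) by simp
    then show "\<exists>c. x = (\<Sum>i<n. c i ^ p * b i)" by blast
  qed
  then obtain I where I: "finite I" "spans b I" and least: "\<And>J. finite J \<Longrightarrow> spans b J \<Longrightarrow> card I \<le> card J"
    using ex_has_least_nat[of "\<lambda>I. finite I \<and> spans b I" "{..<n}" card] by auto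
  text \<open>A nontrivial relation would allow to drop one element of a smallest spanning family.\<close>
  have indep: "c j = 0" if c: "(\<Sum>i\<in>I. c i ^ p * b i) = 0" and j: "j \<in> I" for c j
  proof (rule ccontr)
    assume cj: "c j \<noteq> 0"
    have "spans b (I - {j})"
      unfolding spans_def
    proof
      fix x
      obtain d where d: "x = (\<Sum>i\<in>I. d i ^ p * b i)" using I(2) unfolding spans_def by blast
      \<comment> \<open>Chosen to make \<open>d j + r * c j\<close> vanish; adding
        \<open>r ^ p\<close> times the zero relation leaves \<open>x\<close> unchanged.\<close>
      define r where "r = - (d j / c j)"
      have "x = (\<Sum>i\<in>I. d i ^ p * b i) + r ^ p * (\<Sum>i\<in>I. c i ^ p * b i)"
        using c d by simp
      also have "\<dots> = (\<Sum>i\<in>I. (d i + r * c i) ^ p * b i)"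
        by (simp add: fresh sum_distrib_left sum.distrib algebra_simps)
      also have "\<dots> = (\<Sum>i\<in>I - {j}. (d i + r * c i) ^ p * b i)"
        using cj prime_gt_0_nat[OF prime] by (simp add: sum.remove[OF I(1) j] r_def zero_power)
      finally show "\<exists>c. x = (\<Sum>i\<in>I - {j}. c i ^ p * b i)"
        by (rule exI[of _ "\<lambda>i. d i + r * c i"])
    qed
    then have "card I \<le> card (I - {j})" using least I(1) by simp
    then show False using I(1) j by (metis card_Diff1_less not_less)
  qed
  have minus_pow: "(x - y) ^ p = x ^ p - y ^ p" for x y :: 'k
    using fresh[of "x - y" y] by (simp add: algebra_simps)
  obtain \<rho> where \<rho>: "\<And>x. x = (\<Sum>i\<in>I. \<rho> x i ^ p * b i)"
    using I(2) unfolding spans_def by metis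
  have unique: "\<rho> x j = c j" if "x = (\<Sum>i\<in>I. c i ^ p * b i)" "j \<in> I" for x c j
  proof -
    have "(\<Sum>i\<in>I. (\<rho> x i - c i) ^ p * b i) = 0"
      using \<rho>[of x] that(1) by (simp add: minus_pow left_diff_distrib sum_subtractf)
    then show ?thesis using indep[OF _ that(2)] by fastforce
  qed
  have add: "\<rho> (x + y) i = \<rho> x i + \<rho> y i" if "i \<in> I" for x y i
  proof (rule unique[OF _ that])
    have "x + y = (\<Sum>i\<in>I. \<rho> x i ^ p * b i) + (\<Sum>i\<in>I. \<rho> y i ^ p * b i)"
      using \<rho> by metis
    then show "x + y = (\<Sum>i\<in>I. (\<rho> x i + \<rho> y i) ^ p * b i)"
      by (simp add: fresh distrib_right sum.distrib)
  qed
  have scale: "\<rho> (a ^ p * x) i = a * \<rho> x i" if "i \<in> I" for a x i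
  proof (rule unique[OF _ that])
    have "a ^ p * x = a ^ p * (\<Sum>i\<in>I. \<rho> x i ^ p * b i)"
      using \<rho> by metis
    then show "a ^ p * x = (\<Sum>i\<in>I. (a * \<rho> x i) ^ p * b i)"
      by (simp add: power_mult_distrib sum_distrib_left mult.assoc)
  qed
  have "frobenius_dual_basis UNIV p I (\<lambda>i x. \<rho> x i) b"
    using I(1) \<rho> by (auto simp: frobenius_dual_basis_def add scale)
  then show ?thesis by (rule frobenius_dual_basis_reindex)
qed

section \<open>Polynomial rings\<close>

lemma CHAR_poly_mapping: "CHAR('a::monoid_add \<Rightarrow>\<^sub>0 'b::comm_ring_1) = CHAR('b)"
proof (rule CHAR_eqI)
  show "of_nat CHAR('b) = (0 :: 'a \<Rightarrow>\<^sub>0 'b)"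
    by (metis of_nat_CHAR single_of_nat single_zero)
next
  fix n assume "of_nat n = (0 :: 'a \<Rightarrow>\<^sub>0 'b)"
  then have "of_nat n = (0 :: 'b)"
    by (metis lookup_single_eq lookup_zero single_of_nat)
  then show "CHAR('b) dvd n" by (simp add: of_nat_eq_0_iff_char_dvd)
qed

lemma sum_single_lookup:
  fixes P :: "'a \<Rightarrow>\<^sub>0 'b::comm_monoid_add"
  shows "(\<Sum>m\<in>Poly_Mapping.keys P. Poly_Mapping.single m (Poly_Mapping.lookup P m)) = P"
  by (rule poly_mapping_eqI) (simp add: lookup_sum lookup_single when_def in_keys_iff)

lemma poly_mapping_induct_add [case_names single add]:
  fixes P :: "'a \<Rightarrow>\<^sub>0 'b::comm_monoid_add"
  assumes single: "\<And>m c. Q (Poly_Mapping.single m c)"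
    and add: "\<And>x y. Q x \<Longrightarrow> Q y \<Longrightarrow> Q (x + y)"
  shows "Q P"
proof -
  have "Q (\<Sum>m\<in>M. Poly_Mapping.single m (Poly_Mapping.lookup P m))" if "finite M" for M
    using that
  proof (induction M rule: finite_induct)
    case empty
    show ?case using single[of undefined 0] by simp
  qed (simp add: single add)
  then show ?thesis
    using sum_single_lookup[of P] by (metis finite_keys)
qed

lemma lookup_map_zero: "g 0 = 0 \<Longrightarrow> Poly_Mapping.lookup (Poly_Mapping.map g m) k = g (Poly_Mapping.lookup m k)"
  by (simp add: map.rep_eq when_def)

lemma single_power:
  "Poly_Mapping.single (m :: 'i \<Rightarrow>\<^sub>0 nat) (c :: 'k::comm_ring_1) ^ q = Poly_Mapping.single (Poly_Mapping.map ((*) q) m) (c ^ q)"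
proof (induction q)
  case 0
  have "Poly_Mapping.map ((*) 0) m = 0"
    by (rule poly_mapping_eqI) (simp add: lookup_map_zero)
  then show ?case by (simp only: power_0 single_one)
next
  case (Suc q)
  have "m + Poly_Mapping.map ((*) q) m = Poly_Mapping.map ((*) (Suc q)) m"
    by (rule poly_mapping_eqI) (simp add: lookup_map_zero lookup_add)
  then show ?case using Suc by (simp add: mult_single del: mult_Suc)
qed

text \<open>Coordinates along \<open>X\<^sup>a\<close> of the decomposition of a polynomial by the residues modulo \<open>q\<close> of
  the exponents, composed with a coordinate \<open>g\<close> of the coefficient field.\<close>

definition monomial_coordinate ::
    "nat \<Rightarrow> ('k \<Rightarrow> 'k) \<Rightarrow> ('i \<Rightarrow>\<^sub>0 nat) \<Rightarrow> (('i \<Rightarrow>\<^sub>0 nat) \<Rightarrow>\<^sub>0 'k::comm_ring_1) \<Rightarrow> (('i \<Rightarrow>\<^sub>0 nat) \<Rightarrow>\<^sub>0 'k)" where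
  "monomial_coordinate q g a P = (\<Sum>m\<in>Poly_Mapping.keys P.
     if Poly_Mapping.map (\<lambda>j. j mod q) m = a
     then Poly_Mapping.single (Poly_Mapping.map (\<lambda>j. j div q) m) (g (Poly_Mapping.lookup P m)) else 0)"

text \<open>Cancellation can make the support of a sum smaller; a common larger index set allows
  termwise addition.\<close>

lemma monomial_coordinate_superset:
  assumes "g 0 = 0" "finite M" "Poly_Mapping.keys P \<subseteq> M"
  shows "monomial_coordinate q g a P = (\<Sum>m\<in>M.
     if Poly_Mapping.map (\<lambda>j. j mod q) m = a
     then Poly_Mapping.single (Poly_Mapping.map (\<lambda>j. j div q) m) (g (Poly_Mapping.lookup P m)) else 0)"
  unfolding monomial_coordinate_def
  by (rule sum.mono_neutral_left) (use assms in \<open>auto simp: in_keys_iff\<close>)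

lemma monomial_coordinate_single:
  assumes "g 0 = 0"
  shows "monomial_coordinate q g a (Poly_Mapping.single m c) =
     (if Poly_Mapping.map (\<lambda>j. j mod q) m = a
      then Poly_Mapping.single (Poly_Mapping.map (\<lambda>j. j div q) m) (g c) else 0)"
  using monomial_coordinate_superset[of g, OF assms, of "{m}" "Poly_Mapping.single m c" q a] by simp

lemma monomial_coordinate_add:
  assumes g: "\<And>x y. g (x + y) = g x + g y"
  shows "monomial_coordinate q g a (P + P') = monomial_coordinate q g a P + monomial_coordinate q g a P'"
proof -
  have g0: "g 0 = 0" using g[of 0 0] by simp
  let ?M = "Poly_Mapping.keys P \<union> Poly_Mapping.keys P'"
  have "Poly_Mapping.keys (P + P') \<subseteq> ?M" by (rule Poly_Mapping.keys_add)
  then show ?thesis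
    by (simp add: monomial_coordinate_superset[of g, OF g0, of ?M] sum.distrib[symmetric] lookup_add g single_add if_distrib
        cong: if_cong)
qed

lemma keys_monomial_coordinate:
  assumes "m' \<in> Poly_Mapping.keys (monomial_coordinate q g a P)"
  shows "\<exists>m\<in>Poly_Mapping.keys P. m' = Poly_Mapping.map (\<lambda>j. j div q) m"
proof -
  obtain m where "m \<in> Poly_Mapping.keys P"
    "m' \<in> Poly_Mapping.keys (if Poly_Mapping.map (\<lambda>j. j mod q) m = a
      then Poly_Mapping.single (Poly_Mapping.map (\<lambda>j. j div q) m) (g (Poly_Mapping.lookup P m)) else 0)"
    using subsetD[OF keys_sum assms[unfolded monomial_coordinate_def]] by blast
  then show ?thesis by (intro bexI[of _ m]) (simp_all split: if_splits)
qed

text \<open>Both sides are additive in \<open>A\<close>, by additivity of Frobenius, and in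
  \<open>P\<close>. For monomials, adding \<open>p\<close> times \<open>m\<close> to an exponent
  keeps its residues and adds \<open>m\<close> to its quotients.\<close>

lemma monomial_coordinate_power_mult:
  fixes A P :: "('i \<Rightarrow>\<^sub>0 nat) \<Rightarrow>\<^sub>0 'k::comm_ring_1"
  assumes p: "prime p" "CHAR('k) = p"
    and g: "\<And>x y. g (x + y) = g x + g y" "\<And>c x. g (c ^ p * x) = c * g x"
  shows "monomial_coordinate p g a (A ^ p * P) = A * monomial_coordinate p g a P"
proof (induction A rule: poly_mapping_induct_add)
  case (single m c)
  have g0: "g 0 = 0" using g(1)[of 0 0] by simp
  show ?case
  proof (induction P rule: poly_mapping_induct_add)
    case (single n d)
    let ?s = "Poly_Mapping.map ((*) p) m + n"
    have "Poly_Mapping.map (\<lambda>j. j mod p) ?s = Poly_Mapping.map (\<lambda>j. j mod p) n"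
      by (rule poly_mapping_eqI) (simp add: lookup_map_zero lookup_add)
    moreover have "Poly_Mapping.map (\<lambda>j. j div p) ?s = m + Poly_Mapping.map (\<lambda>j. j div p) n"
      using prime_gt_0_nat[OF p(1)]
      by (intro poly_mapping_eqI) (simp add: lookup_map_zero lookup_add)
    ultimately show ?case
      by (simp add: single_power mult_single monomial_coordinate_single[of g, OF g0] g(2))
  qed (simp add: distrib_left monomial_coordinate_add g(1))
next
  case (add x y)
  have "(x + y) ^ p = x ^ p + y ^ p"
    by (rule freshmans_dream) (simp_all add: CHAR_poly_mapping p)
  then show ?case
    using add by (simp add: distrib_right monomial_coordinate_add g(1))
qed

section \<open>The dual basis of the polynomial ring\<close>

definition reduced_exponents :: "nat \<Rightarrow> nat \<Rightarrow> (nat \<Rightarrow>\<^sub>0 nat) set" where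
  "reduced_exponents N q = {a. Poly_Mapping.keys a \<subseteq> {..<N} \<and> (\<forall>i. Poly_Mapping.lookup a i < q)}"

lemma finite_reduced_exponents: "finite (reduced_exponents N q)"
proof (rule inj_on_finite)
  show "inj_on (\<lambda>a. restrict (Poly_Mapping.lookup a) {..<N}) (reduced_exponents N q)"
  proof (rule inj_onI, rule poly_mapping_eqI)
    fix a b i
    assume ab: "a \<in> reduced_exponents N q" "b \<in> reduced_exponents N q"
      "restrict (Poly_Mapping.lookup a) {..<N} = restrict (Poly_Mapping.lookup b) {..<N}"
    show "Poly_Mapping.lookup a i = Poly_Mapping.lookup b i"
    proof (cases "i < N")
      case True
      then show ?thesis using fun_cong[OF ab(3), of i] by simp
    next
      case False
      then have "i \<notin> Poly_Mapping.keys a" "i \<notin> Poly_Mapping.keys b"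
        using ab(1,2) by (auto simp: reduced_exponents_def)
      then show ?thesis by (simp add: in_keys_iff)
    qed
  qed
  show "(\<lambda>a. restrict (Poly_Mapping.lookup a) {..<N}) ` reduced_exponents N q \<subseteq> PiE {..<N} (\<lambda>_. {..<q})"
    by (auto simp: reduced_exponents_def split: if_splits)
  show "finite (PiE {..<N} (\<lambda>_. {..<q}))" by (intro finite_PiE) auto
qed

text \<open>The basis consists of the products of the \<open>\<beta> i\<close> with monomials of
  reduced exponent. The reconstruction map \<open>T\<close> is additive, so it is checked on single
  terms, where only the residue of the exponent contributes.\<close>

lemma dual_basis_mpoly_ring:
  fixes \<pi> :: "'j \<Rightarrow> 'k::comm_ring_1 \<Rightarrow> 'k"
  assumes p: "prime p" "CHAR('k) = p" and D: "frobenius_dual_basis (UNIV :: 'k set) p I \<pi> \<beta>"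
  shows "frobenius_dual_basis (carrier (mpoly_ring N)) p (I \<times> reduced_exponents N p)
    (\<lambda>(i, a). monomial_coordinate p (\<pi> i) a) (\<lambda>(i, a). Poly_Mapping.single a (\<beta> i))"
proof -
  note D' = frobenius_dual_basisD[OF D]
  let ?C = "carrier (mpoly_ring N) :: ((nat \<Rightarrow>\<^sub>0 nat) \<Rightarrow>\<^sub>0 'k) set"
  define T where "T = (\<lambda>x :: (nat \<Rightarrow>\<^sub>0 nat) \<Rightarrow>\<^sub>0 'k. \<Sum>(i, a)\<in>I \<times> reduced_exponents N p.
    monomial_coordinate p (\<pi> i) a x ^ p * Poly_Mapping.single a (\<beta> i))"
  have \<pi>0: "\<pi> i 0 = 0" if "i \<in> I" for i
    using D'(4)[OF that, of 0 0] by simp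
  have fresh: "(x + y) ^ p = x ^ p + y ^ p" for x y :: "(nat \<Rightarrow>\<^sub>0 nat) \<Rightarrow>\<^sub>0 'k"
    by (rule freshmans_dream) (simp_all add: CHAR_poly_mapping p)
  have T_add: "T (x + y) = T x + T y" for x y
  proof -
    have "monomial_coordinate p (\<pi> i) a (x + y) = monomial_coordinate p (\<pi> i) a x + monomial_coordinate p (\<pi> i) a y"
      if "i \<in> I" for i a
      by (rule monomial_coordinate_add) (simp add: D'(4)[OF that])
    then have "T (x + y) = (\<Sum>(i, a)\<in>I \<times> reduced_exponents N p.
        monomial_coordinate p (\<pi> i) a x ^ p * Poly_Mapping.single a (\<beta> i)
        + monomial_coordinate p (\<pi> i) a y ^ p * Poly_Mapping.single a (\<beta> i))"
      unfolding T_def by (intro sum.cong) (auto simp: fresh distrib_right)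
    also have "\<dots> = T x + T y"
      by (simp add: T_def case_prod_unfold sum.distrib)
    finally show ?thesis .
  qed
  have T_single: "T (Poly_Mapping.single m c) = Poly_Mapping.single m c" if m: "Poly_Mapping.keys m \<subseteq> {..<N}" for m c
  proof -
    let ?d = "Poly_Mapping.map (\<lambda>j. j div p) m" and ?r = "Poly_Mapping.map (\<lambda>j. j mod p) m"
    have r: "?r \<in> reduced_exponents N p"
    proof -
      have "k \<in> Poly_Mapping.keys m" if "k \<in> Poly_Mapping.keys ?r" for k
        using that by (cases "Poly_Mapping.lookup m k = 0") (simp_all add: in_keys_iff lookup_map_zero)
      then have "Poly_Mapping.keys ?r \<subseteq> {..<N}" using m by blast
      then show ?thesis
        using prime_gt_0_nat[OF p(1)] by (simp add: reduced_exponents_def lookup_map_zero)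
    qed
    have dr: "Poly_Mapping.map ((*) p) ?d + ?r = m"
      by (rule poly_mapping_eqI) (simp add: lookup_map_zero lookup_add)
    have "T (Poly_Mapping.single m c) = (\<Sum>i\<in>I. \<Sum>a\<in>reduced_exponents N p.
        if a = ?r then Poly_Mapping.single m (\<pi> i c ^ p * \<beta> i) else 0)"
      unfolding T_def sum.cartesian_product[symmetric]
    proof (intro sum.cong refl)
      fix i a assume i: "i \<in> I"
      show "monomial_coordinate p (\<pi> i) a (Poly_Mapping.single m c) ^ p * Poly_Mapping.single a (\<beta> i)
          = (if a = ?r then Poly_Mapping.single m (\<pi> i c ^ p * \<beta> i) else 0)"
        using prime_gt_0_nat[OF p(1)]
        unfolding monomial_coordinate_single[of "\<pi> i", OF \<pi>0[OF i]]
        by (cases "a = ?r") (simp_all add: single_power mult_single dr zero_power)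
    qed
    also have "\<dots> = (\<Sum>i\<in>I. Poly_Mapping.single m (\<pi> i c ^ p * \<beta> i))"
      using r by (simp add: finite_reduced_exponents)
    also have "\<dots> = Poly_Mapping.single m (\<Sum>i\<in>I. \<pi> i c ^ p * \<beta> i)"
      by (induction I rule: infinite_finite_induct) (auto simp: single_add)
    finally show ?thesis using D'(6)[of c] by simp
  qed
  have T: "T x = x" if x: "x \<in> ?C" for x
  proof -
    have "T (\<Sum>m\<in>M. Poly_Mapping.single m (Poly_Mapping.lookup x m)) = (\<Sum>m\<in>M. Poly_Mapping.single m (Poly_Mapping.lookup x m))"
      if "finite M" "\<forall>m\<in>M. Poly_Mapping.keys m \<subseteq> {..<N}" for M
      using that
    proof (induction M rule: finite_induct)
      case empty
      show ?case using T_single[of 0 0] by simp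
    qed (simp add: T_add T_single)
    from this[of "Poly_Mapping.keys x"] show ?thesis
      using x by (simp add: sum_single_lookup)
  qed
  have closed: "monomial_coordinate p g a x \<in> ?C" if x: "x \<in> ?C" for g a x
  proof -
    have "Poly_Mapping.keys m' \<subseteq> {..<N}" if "m' \<in> Poly_Mapping.keys (monomial_coordinate p g a x)" for m'
    proof -
      obtain m where m: "m \<in> Poly_Mapping.keys x" "m' = Poly_Mapping.map (\<lambda>j. j div p) m"
        using keys_monomial_coordinate[OF \<open>m' \<in> _\<close>] by blast
      have "k \<in> Poly_Mapping.keys m" if "k \<in> Poly_Mapping.keys m'" for k
        using that m(2) by (cases "Poly_Mapping.lookup m k = 0") (simp_all add: in_keys_iff lookup_map_zero)
      then show ?thesis using x m(1) by auto
    qed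
    then show ?thesis by simp
  qed
  show ?thesis
    unfolding frobenius_dual_basis_def
  proof (intro conjI ballI)
    show "finite (I \<times> reduced_exponents N p)" using D'(1) finite_reduced_exponents by simp
    fix k assume k: "k \<in> I \<times> reduced_exponents N p"
    then obtain i a where ia: "k = (i, a)" "i \<in> I" "a \<in> reduced_exponents N p" by auto
    show "(case k of (i, a) \<Rightarrow> Poly_Mapping.single a (\<beta> i)) \<in> ?C"
      using ia by (auto simp: reduced_exponents_def)
    show "(case k of (i, a) \<Rightarrow> monomial_coordinate p (\<pi> i) a) x \<in> ?C" if "x \<in> ?C" for x
      unfolding ia(1) prod.case by (rule closed[OF that])
    show "(case k of (i, a) \<Rightarrow> monomial_coordinate p (\<pi> i) a) (x + y)
      = (case k of (i, a) \<Rightarrow> monomial_coordinate p (\<pi> i) a) x + (case k of (i, a) \<Rightarrow> monomial_coordinate p (\<pi> i) a) y" for x y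
      using ia by (simp add: monomial_coordinate_add D'(4))
    show "(case k of (i, a) \<Rightarrow> monomial_coordinate p (\<pi> i) a) (x ^ p * y)
      = x * (case k of (i, a) \<Rightarrow> monomial_coordinate p (\<pi> i) a) y" for x y
      using ia D'(5)[OF ia(2)] by (simp add: monomial_coordinate_power_mult p D'(4))
  next
    show "x = (\<Sum>k\<in>I \<times> reduced_exponents N p. (case k of (i, a) \<Rightarrow> monomial_coordinate p (\<pi> i) a) x ^ p
        * (case k of (i, a) \<Rightarrow> Poly_Mapping.single a (\<beta> i)))" if "x \<in> ?C" for x
      using T[OF that] by (simp add: T_def case_prod_unfold)
  qed
qed

text \<open>Descent on a bound for the exponents: taking a nonzero coordinate divides the bound by
  \<open>p\<close>, until a nonzero constant remains, which is a unit because the coefficients form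
  a field.\<close>

lemma mpoly_ring_frobenius_root_eq_carrier:
  fixes f :: "(nat \<Rightarrow>\<^sub>0 nat) \<Rightarrow>\<^sub>0 'k::field" and \<pi> :: "'j \<Rightarrow> 'k \<Rightarrow> 'k"
  assumes R: "frobenius_ring (mpoly_ring N :: ((nat \<Rightarrow>\<^sub>0 nat) \<Rightarrow>\<^sub>0 'k) ring) p" and p: "prime p"
    and D: "frobenius_dual_basis (carrier (mpoly_ring N)) p (I \<times> reduced_exponents N p)
      (\<lambda>(i, a). monomial_coordinate p (\<pi> i) a) (\<lambda>(i, a). Poly_Mapping.single a (\<beta> i))"
    and f: "f \<in> carrier (mpoly_ring N)" "f \<noteq> 0"
  shows "\<exists>k. frobenius_root (mpoly_ring N) p k f = carrier (mpoly_ring N)"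
proof -
  interpret frobenius_ring "mpoly_ring N :: ((nat \<Rightarrow>\<^sub>0 nat) \<Rightarrow>\<^sub>0 'k) ring" p by (rule R)
  let ?C = "carrier (mpoly_ring N) :: ((nat \<Rightarrow>\<^sub>0 nat) \<Rightarrow>\<^sub>0 'k) set"
  note D' = frobenius_dual_basisD[OF D]
  have bounded: "\<exists>k. frobenius_root (mpoly_ring N) p k f = ?C"
    if "f \<in> ?C" "f \<noteq> 0" "\<forall>m\<in>Poly_Mapping.keys f. \<forall>i. Poly_Mapping.lookup m i \<le> d" for d f
    using that
  proof (induction d arbitrary: f rule: less_induct)
    case (less d)
    show ?case
    proof (cases "d = 0")
      case True
      then have keys: "Poly_Mapping.keys f \<subseteq> {0}"
        using less.prems(3) by (auto intro: poly_mapping_eqI)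
      define c where "c = Poly_Mapping.lookup f 0"
      have fc: "f = Poly_Mapping.single 0 c"
        by (rule poly_mapping_eqI) (use keys in \<open>auto simp: lookup_single when_def c_def in_keys_iff\<close>)
      then have "c \<noteq> 0" using less.prems(2) by auto
      then have "Poly_Mapping.single 0 (inverse c) * f = 1"
        unfolding fc by (simp add: mult_single)
      then have "frobenius_root (mpoly_ring N) p 0 f = ?C"
        by (intro root_zero_eq_carrier_of_unit[OF less.prems(1), of "Poly_Mapping.single 0 (inverse c)"]) auto
      then show ?thesis by blast
    next
      case False
      \<comment> \<open>The coordinates reconstruct \<open>f\<close>, so they cannot all
        vanish.\<close>
      have "\<exists>k\<in>I \<times> reduced_exponents N p. (case k of (i, a) \<Rightarrow> monomial_coordinate p (\<pi> i) a) f \<noteq> 0"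
      proof (rule ccontr)
        assume "\<not> ?thesis"
        then have "(\<Sum>k\<in>I \<times> reduced_exponents N p. (case k of (i, a) \<Rightarrow> monomial_coordinate p (\<pi> i) a) f ^ p
            * (case k of (i, a) \<Rightarrow> Poly_Mapping.single a (\<beta> i))) = 0"
          using prime_gt_0_nat[OF p] by (intro sum.neutral ballI) (auto simp: zero_power)
        then show False using D'(6)[OF less.prems(1)] less.prems(2) by metis
      qed
      then obtain k where k: "k \<in> I \<times> reduced_exponents N p"
        "(case k of (i, a) \<Rightarrow> monomial_coordinate p (\<pi> i) a) f \<noteq> 0" (is "?g \<noteq> 0") by blast
      obtain i a where ia: "k = (i, a)" by (cases k)
      have "\<forall>m\<in>Poly_Mapping.keys ?g. \<forall>j. Poly_Mapping.lookup m j \<le> d div p"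
      proof (intro ballI allI)
        fix m j assume "m \<in> Poly_Mapping.keys ?g"
        then obtain m' where "m' \<in> Poly_Mapping.keys f" "m = Poly_Mapping.map (\<lambda>j. j div p) m'"
          using keys_monomial_coordinate unfolding ia prod.case by blast
        then show "Poly_Mapping.lookup m j \<le> d div p"
          using less.prems(3) by (simp add: lookup_map_zero div_le_mono)
      qed
      moreover have "d div p < d"
        using False prime_gt_1_nat[OF p] by simp
      ultimately obtain l where "frobenius_root (mpoly_ring N) p l ?g = ?C"
        using less.IH[of "d div p" ?g] D'(3)[OF k(1) less.prems(1)] k(2) by blast
      then show ?thesis
        using root_eq_carrier_of_coordinate[OF D k(1) less.prems(1)] by blast
    qed
  qed
  have "\<exists>d. \<forall>m\<in>Poly_Mapping.keys f. \<forall>i. Poly_Mapping.lookup m i \<le> d"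
  proof -
    let ?V = "\<Union>m\<in>Poly_Mapping.keys f. insert 0 (Poly_Mapping.lookup m ` Poly_Mapping.keys m)"
    have "Poly_Mapping.lookup m i \<in> ?V" if "m \<in> Poly_Mapping.keys f" for m i
    proof (cases "i \<in> Poly_Mapping.keys m")
      case True
      then show ?thesis using that by (intro UN_I[OF that]) simp
    next
      case False
      then show ?thesis using that by (intro UN_I[OF that]) (simp add: in_keys_iff)
    qed
    moreover have "finite ?V" by simp
    ultimately show ?thesis by (intro exI[of _ "Max ?V"]) (auto intro!: Max_ge)
  qed
  then show ?thesis using bounded[OF f] by blast
qed

section \<open>Specialisation to polynomial rings over F-finite fields\<close>

theorem mainTheorem4:
  fixes p N B u v s :: nat
    and f :: "(nat \<Rightarrow>\<^sub>0 nat) \<Rightarrow>\<^sub>0 'k::field"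
    and R :: "((nat \<Rightarrow>\<^sub>0 nat) \<Rightarrow>\<^sub>0 'k) ring"
    and \<alpha> :: real
  assumes "CHAR('k) = p" and "p > 0"
    and "F_finite (ring_of_type_algebra :: 'k ring) p"
    and "R = mpoly_ring N"
    and "f \<in> carrier R"
    and "B > 0"
    and "finite (F_jumping_numbers R p f \<inter> {0..<1})"
    and "card (F_jumping_numbers R p f \<inter> {0..<1}) \<le> B"
    and "\<alpha> \<in> bounded_rationals p B" and "\<alpha> > 0"
    and "minimal_exponent_pair p \<alpha> = (u, v)"
    and "s = u + v * B"
  shows "(\<alpha> \<in> F_jumping_numbers R p f \<longleftrightarrow>
            test_ideal R p f (truncation p s \<alpha>)
              \<noteq> test_ideal R p f (truncation p s \<alpha> + 1 / real p ^ s))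
       \<and> test_ideal R p f (truncation p s \<alpha>)
           = frobenius_root R p s (f [^]\<^bsub>R\<^esub> (nat (\<lceil>real p ^ s * \<alpha>\<rceil> - 1)))
       \<and> test_ideal R p f (truncation p s \<alpha> + 1 / real p ^ s)
           = frobenius_root R p s (f [^]\<^bsub>R\<^esub> (nat \<lceil>real p ^ s * \<alpha>\<rceil>))"
proof -
  have p: "prime p"
    using assms(1,2) prime_CHAR_semidom[where ?'a = 'k] by simp
  obtain n :: nat and \<pi> \<beta> where "frobenius_dual_basis (UNIV :: 'k set) p {..<n} \<pi> \<beta>"
    using F_finite_imp_dual_basis[OF assms(1-3)] by blast
  note D = dual_basis_mpoly_ring[OF p assms(1) this, of N]
  have R: "frobenius_ring (mpoly_ring N :: ((nat \<Rightarrow>\<^sub>0 nat) \<Rightarrow>\<^sub>0 'k) ring) p"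
    unfolding frobenius_ring_def frobenius_ring_axioms_def
  proof (intro conjI)
    show "mpoly_ring N = (ring_of_type_algebra\<lparr>carrier := carrier (mpoly_ring N)\<rparr>
        :: ((nat \<Rightarrow>\<^sub>0 nat) \<Rightarrow>\<^sub>0 'k) ring)"
      by (simp add: mpoly_ring_def)
  qed (use cring_mpoly_ring p frobenius_dual_basis_reindex[OF D] in \<open>simp_all add: CHAR_poly_mapping assms(1)\<close>)
  interpret frobenius_ring R p unfolding \<open>R = mpoly_ring N\<close> by (rule R)
  have reg: "f = 0 \<or> (\<exists>k. frobenius_root R p k f = carrier R)"
    using mpoly_ring_frobenius_root_eq_carrier[OF R p D] assms(4,5) by blast
  have \<alpha>: "\<alpha> \<in> \<rat>"
    using assms(9,10) by (auto simp: bounded_rationals_def)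
  note uv = minimal_exponent_pairD[OF p \<alpha> assms(10,11)]
  \<comment> \<open>As \<open>v\<close> is at least 1, the bound \<open>p ^ B * \<alpha> > 1\<close>
    carries over to level \<open>s\<close>.\<close>
  have "B \<le> s"
    unfolding \<open>s = u + v * B\<close> using uv(1) by (simp add: trans_le_add2)
  then have "real p ^ B * \<alpha> \<le> real p ^ s * \<alpha>"
    using prime_gt_1_nat[OF p] assms(10) by (intro mult_right_mono power_increasing) auto
  moreover have "real p ^ B * \<alpha> > 1"
    by (rule bounded_rationals_power_mult_gt_one[OF prime_gt_1_nat[OF p] assms(9,10)])
  ultimately have "real p ^ s * \<alpha> > 1" by simp
  note main = F_jumping_number_iff_truncation[OF assms(5) reg assms(7,8) uv(2,1) assms(12) this]
  show ?thesis
    unfolding nat_pow_eq using main by blast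
qed

end
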